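(* Let $(X,f)$ be a dynamical system with an expansive $\ell$-Markov partition $\mathscr{H}=\{H_i\}$, $\lambda(H_i)<\infty$ for all $i$, whose transition matrix $P$ defines an irreducible, aperiodic, positive recurrent Markov chain. Let $\pi$ be the absolutely continuous measure on $\mathscr{L}(X)$ with density $\tau$, where $\tau(x)=\frac{\lim_{k\to\infty}p_{ii}^{(k)}}{\lambda(H_i)}$ for all $x\in\operatorname{int}(H_i)$ and all $i$. Then the system $(X,f)$ with the measure $\pi$ is mixing, i.e. $\lim_{k\to\infty}\pi(f^{-k}(A)\cap B)=\pi(A)\,\pi(B)$ for all $A,B\in\mathscr{L}(X)$.
   Context: $\lambda$ is Lebesgue measure and $\mathscr{L}(X)$ is the Lebesgue $\sigma$-algebra on $X$; measurable means Lebesgue measurable. A measure $\mu$ on $\mathscr{L}(X)$ is absolutely continuous with density $\gamma:X\to[0,\infty]$ if $\mu(H)=\int_H\gamma\,d\lambda$ for all $H\in\mathscr{L}(X)$. "Linear" means affine. $\ell$-Markov partition: Let $X\subseteq\mathbb{R}$ be a measurable set which is a countable union of closed intervals with non-empty interiors, and $f:X\to X$ measurable. $(X,f)$ has an $\ell$-Markov partition $\mathscr{H}$ if $\mathscr{H}$ is a countable (finite or countably infinite) set of closed subintervals of $\mathbb{R}$ with non-empty interior such that: (1) $\operatorname{int}(A)\cap\operatorname{int}(B)=\emptyset$ for distinct $A,B\in\mathscr{H}$; (2) $X=\bigcup\mathscr{H}$; (3) for all $A\in\mathscr{H}$ there is $\emptyset\ne\mathscr{A}\subseteq\mathscr{H}$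 with $\operatorname{int}(f(A))=\operatorname{int}(\bigcup\mathscr{A})$; (4) $f$ is linear on the interior of each $H\in\mathscr{H}$. The elements of $\mathscr{H}$ are enumerated as $H_i$, with $i$ ranging over $\mathbb{Z}^+$ (or over $\{1,\dots,m\}$ if $\mathscr{H}$ has $m<\infty$ elements). For a finite sequence of indices let $H_{i_0\dots i_n}=\bigcap_{k=0}^n f^{-k}(H_{i_k})$. The partition is expansive if for every $\delta>0$ and every bounded interval $I\subseteq X$ there are finitely many finite index sequences $(i^{(k)}_0,\dots,i^{(k)}_{n_k})$, $1\le k\le N$, with $\lambda\big(I\,\Delta\,\bigcup_{k=1}^N H_{i^{(k)}_0\dots i^{(k)}_{n_k}}\big)<\delta$, where $\Delta$ denotes symmetric difference. Transition matrix (defined when all $\lambda(H_i)<\infty$): $P=(p_{ij})$ with $p_{ij}=\frac{\lambda(H_j)}{\lambda(H_i)\,|f'(H_i)|}$ if $\operatorname{int}(H_j)\subseteq f(H_i)$ and $p_{ij}=0$ otherwise, where $f'(H_i)$ is the slope of $f$ on $\operatorname{int}(H_i)$. $P$ is row-stochastic and defines a Markov chain on the index set; $p_{ij}^{(k)}=(P^k)_{ij}$. Positive recurrent means that every state is recurrent (return probability $1$) with finite mean return time. *)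

theory Defs
  imports "HOL-Analysis.Analysis"
begin

definition closed_nd_interval :: "real set \<Rightarrow> bool" where
  "closed_nd_interval A \<longleftrightarrow> closed A \<and> is_interval A \<and> interior A \<noteq> {}"

text \<open>A self-map of \<open>X\<close> is a total function that maps \<open>X\<close> into \<open>X\<close>; its values outside \<open>X\<close> are
  irrelevant. The sigma-algebra on both copies of \<open>X\<close> is that of the Lebesgue measurable subsets
  of \<open>X\<close>.\<close>

definition interval_system :: "real set \<Rightarrow> (real \<Rightarrow> real) \<Rightarrow> bool" where
  "interval_system X f \<longleftrightarrow>
     X \<in> sets lebesgue \<and>
     (\<exists>\<C>. countable \<C> \<and> (\<forall>C\<in>\<C>. closed_nd_interval C) \<and> X = \<Union>\<C>) \<and>
     f \<in> lebesgue_on X \<rightarrow>\<^sub>M lebesgue_on X"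

definition affine_on_set :: "real set \<Rightarrow> (real \<Rightarrow> real) \<Rightarrow> bool" where
  "affine_on_set S f \<longleftrightarrow> (\<exists>a b. \<forall>x\<in>S. f x = a * x + b)"

definition linear_markov_partition :: "real set \<Rightarrow> (real \<Rightarrow> real) \<Rightarrow> real set set \<Rightarrow> bool" where
  "linear_markov_partition X f \<H> \<longleftrightarrow>
     countable \<H> \<and> (\<forall>A\<in>\<H>. closed_nd_interval A) \<and>
     (\<forall>A\<in>\<H>. \<forall>B\<in>\<H>. A \<noteq> B \<longrightarrow> interior A \<inter> interior B = {}) \<and>
     X = \<Union>\<H> \<and>
     (\<forall>A\<in>\<H>. \<exists>\<A>. \<A> \<noteq> {} \<and> \<A> \<subseteq> \<H> \<and> interior (f ` A) = interior (\<Union>\<A>)) \<and>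
     (\<forall>A\<in>\<H>. affine_on_set (interior A) f)"

definition enumerates :: "nat set \<Rightarrow> (nat \<Rightarrow> 'a) \<Rightarrow> 'a set \<Rightarrow> bool" where
  "enumerates I H \<H> \<longleftrightarrow> (I = {1..} \<or> (\<exists>m. I = {1..m})) \<and> bij_betw H I \<H>"

definition cylinder ::
  "real set \<Rightarrow> (real \<Rightarrow> real) \<Rightarrow> (nat \<Rightarrow> real set) \<Rightarrow> nat list \<Rightarrow> real set" where
  "cylinder X f H w = {x \<in> X. \<forall>k<length w. (f ^^ k) x \<in> H (w ! k)}"

definition expansive ::
  "real set \<Rightarrow> (real \<Rightarrow> real) \<Rightarrow> nat set \<Rightarrow> (nat \<Rightarrow> real set) \<Rightarrow> bool" where
  "expansive X f I H \<longleftrightarrow>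
     (\<forall>\<delta>::real. \<forall>J. \<delta> > 0 \<and> is_interval J \<and> bounded J \<and> J \<subseteq> X \<longrightarrow>
       (\<exists>W. finite W \<and> (\<forall>w\<in>W. w \<noteq> [] \<and> set w \<subseteq> I) \<and>
         emeasure lebesgue (sym_diff J (\<Union>w\<in>W. cylinder X f H w)) < ennreal \<delta>))"

text \<open>Well defined for \<open>f\<close> affine on \<open>interior A\<close> if \<open>interior A\<close> is non-empty.\<close>

definition slope :: "(real \<Rightarrow> real) \<Rightarrow> real set \<Rightarrow> real" where
  "slope f A = (THE a. \<exists>b. \<forall>x\<in>interior A. f x = a * x + b)"

definition transition_matrix ::
  "(real \<Rightarrow> real) \<Rightarrow> (nat \<Rightarrow> real set) \<Rightarrow> nat \<Rightarrow> nat \<Rightarrow> real" where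
  "transition_matrix f H i j =
     (if interior (H j) \<subseteq> f ` H i
      then measure lebesgue (H j) / (measure lebesgue (H i) * \<bar>slope f (H i)\<bar>) else 0)"

text \<open>In the following, a matrix indexed by \<open>I\<close> is a function of two arguments that matters on
  \<open>I \<times> I\<close> only. It is meant to be non-negative and row-stochastic, so that all the (possibly
  infinite) sums below converge.\<close>

primrec matpow :: "nat set \<Rightarrow> (nat \<Rightarrow> nat \<Rightarrow> real) \<Rightarrow> nat \<Rightarrow> nat \<Rightarrow> nat \<Rightarrow> real" where
  "matpow I p 0 i j = (if i = j then 1 else 0)"
| "matpow I p (Suc k) i j = (\<Sum>\<^sub>\<infinity>l\<in>I. p i l * matpow I p k l j)"

definition chain_irreducible :: "nat set \<Rightarrow> (nat \<Rightarrow> nat \<Rightarrow> real) \<Rightarrow> bool" where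
  "chain_irreducible I p \<longleftrightarrow> (\<forall>i\<in>I. \<forall>j\<in>I. \<exists>k. matpow I p k i j > 0)"

definition chain_aperiodic :: "nat set \<Rightarrow> (nat \<Rightarrow> nat \<Rightarrow> real) \<Rightarrow> bool" where
  "chain_aperiodic I p \<longleftrightarrow> (\<forall>i\<in>I. Gcd {k. k \<ge> 1 \<and> matpow I p k i i > 0} = 1)"

text \<open>\<open>first_passage I p n i j\<close> is the probability that the chain started in \<open>i\<close> is in \<open>j\<close> at time
  \<open>n\<close> but at none of the times \<open>1, \<dots>, n - 1\<close>: the sum over all \<open>l\<^sub>1, \<dots>, l\<^bsub>n-1\<^esub>\<close> in \<open>I - {j}\<close> of
  \<open>p i l\<^sub>1 * p l\<^sub>1 l\<^sub>2 * \<dots> * p l\<^bsub>n-1\<^esub> j\<close>. For \<open>i = j\<close> this is the distribution of the return time.\<close>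

fun first_passage :: "nat set \<Rightarrow> (nat \<Rightarrow> nat \<Rightarrow> real) \<Rightarrow> nat \<Rightarrow> nat \<Rightarrow> nat \<Rightarrow> real" where
  "first_passage I p 0 i j = 0"
| "first_passage I p (Suc 0) i j = p i j"
| "first_passage I p (Suc (Suc n)) i j =
     (\<Sum>\<^sub>\<infinity>l\<in>I - {j}. p i l * first_passage I p (Suc n) l j)"

definition chain_positive_recurrent :: "nat set \<Rightarrow> (nat \<Rightarrow> nat \<Rightarrow> real) \<Rightarrow> bool" where
  "chain_positive_recurrent I p \<longleftrightarrow>
     (\<forall>i\<in>I. (\<lambda>n. first_passage I p n i i) sums 1 \<and>
            summable (\<lambda>n. real n * first_passage I p n i i))"

definition mixing :: "real measure \<Rightarrow> (real \<Rightarrow> real) \<Rightarrow> bool" where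
  "mixing M f \<longleftrightarrow>
     (\<forall>A\<in>sets M. \<forall>B\<in>sets M.
       (\<lambda>k. emeasure M ({x \<in> space M. (f ^^ k) x \<in> A} \<inter> B))
         \<longlonglongrightarrow> emeasure M A * emeasure M B)"

end

theory Submission
  imports Defs "HOL-Library.Diagonal_Subsequence" "HOL-Probability.Probability_Measure"
begin

text \<open>Let \<open>q\<^sub>i\<close> be normalized Lebesgue measure on \<open>H\<^sub>i\<close>. As \<open>f\<close> is affine on \<open>H\<^sub>i\<close> and maps it
  essentially onto a union of partition elements, \<open>q\<^sub>i(f\<^sup>-\<^sup>1 E) = (\<Sum>j. p\<^sub>i\<^sub>j q\<^sub>j(E))\<close>. Hence the
  convergence theorem for Markov chains gives \<open>q\<^sub>i(f\<^sup>-\<^sup>k A) \<longlonglongrightarrow> \<pi>(A)\<close>, and by induction on the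
  word \<open>w\<close> also \<open>q\<^sub>i(C\<^sub>w \<inter> f\<^sup>-\<^sup>k A) \<longlonglongrightarrow> q\<^sub>i(C\<^sub>w) \<pi>(A)\<close> for every cylinder \<open>C\<^sub>w\<close>. The sets
  \<open>B\<close> in place of \<open>C\<^sub>w\<close> for which this holds form a Dynkin system that is closed under
  approximation in measure, so expansivity extends the limit to intervals and then to all measurable
  sets. Averaging over \<open>i\<close> with the stationary weights gives mixing.

  The convergence theorem rests on the renewal theorem, which is proved after Erdos, Feller and
  Pollard: a limit of shifts of \<open>u\<close> along a subsequence that realizes the limit superior (or
  inferior) satisfies the backward renewal equation and is therefore eventually constant, and the
  total probability of the last renewal before \<open>n\<close> determines the constant.\<close>

section \<open>Limits of sums\<close>

text \<open>Tannery's theorem for a majorant that is valid for every \<open>n\<close>, not only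
  eventually.\<close>

lemma suminf_dominated_convergence:
  fixes a :: "nat \<Rightarrow> nat \<Rightarrow> real"
  assumes "\<And>k. (\<lambda>n. a k n) \<longlonglongrightarrow> b k" "\<And>k n. \<bar>a k n\<bar> \<le> M k" "summable M"
  shows "(\<lambda>n. \<Sum>k. a k n) \<longlonglongrightarrow> (\<Sum>k. b k)"
proof -
  have "\<forall>\<^sub>F (k, n) in at_top \<times>\<^sub>F sequentially. norm (a k n) \<le> M k"
    using assms(2) by (intro always_eventually) auto
  from tannerys_theorem[OF assms(1) this assms(3)] show ?thesis by simp
qed

lemma has_sum_sum:
  fixes f :: "'a \<Rightarrow> 'b \<Rightarrow> real"
  assumes "\<And>x. x \<in> F \<Longrightarrow> (f x has_sum S x) A"
  shows "((\<lambda>y. \<Sum>x\<in>F. f x y) has_sum sum S F) A"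
  using assms by (induction F rule: infinite_finite_induct) (auto intro: has_sum_add)

lemma infsum_sum:
  fixes f :: "'a \<Rightarrow> 'b \<Rightarrow> real"
  assumes "\<And>x. x \<in> F \<Longrightarrow> f x summable_on A"
  shows "(\<Sum>\<^sub>\<infinity>y\<in>A. \<Sum>x\<in>F. f x y) = (\<Sum>x\<in>F. infsum (f x) A)"
  by (intro infsumI has_sum_sum has_sum_infsum assms)

lemma summable_on_sum:
  fixes f :: "'a \<Rightarrow> 'b \<Rightarrow> real"
  assumes "\<And>x. x \<in> F \<Longrightarrow> f x summable_on A"
  shows "(\<lambda>y. \<Sum>x\<in>F. f x y) summable_on A"
  by (rule has_sum_imp_summable[OF has_sum_sum[OF has_sum_infsum[OF assms]]])

lemma summable_on_diff:
  fixes f g :: "'a \<Rightarrow> real"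
  assumes "f summable_on A" "g summable_on A"
  shows "(\<lambda>x. f x - g x) summable_on A"
  using summable_on_add[of f A "\<lambda>x. - g x"] assms by (simp add: summable_on_uminus)

lemma infsum_diff:
  fixes f g :: "'a \<Rightarrow> real"
  assumes "f summable_on A" "g summable_on A"
  shows "(\<Sum>\<^sub>\<infinity>x\<in>A. f x - g x) = infsum f A - infsum g A"
  using infsum_add[of f A "\<lambda>x. - g x"] assms by (simp add: infsum_uminus summable_on_uminus)

text \<open>Extending all families by zero outside \<open>I\<close> turns the sums over
  \<open>I\<close> into ordinary series, to which Tannery's theorem applies. The limits
  \<open>b i\<close> inherit the majorant \<open>M i\<close>, so their sum converges as
  well.\<close>

lemma infsum_dominated_convergence:
  fixes a :: "nat \<Rightarrow> nat \<Rightarrow> real"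
  assumes lim: "\<And>i. i \<in> I \<Longrightarrow> (\<lambda>n. a i n) \<longlonglongrightarrow> b i"
    and bound: "\<And>i n. i \<in> I \<Longrightarrow> \<bar>a i n\<bar> \<le> M i" and M: "M summable_on I"
  shows "(\<lambda>n. \<Sum>\<^sub>\<infinity>i\<in>I. a i n) \<longlonglongrightarrow> (\<Sum>\<^sub>\<infinity>i\<in>I. b i)"
proof -
  define ext where "ext = (\<lambda>(g :: nat \<Rightarrow> real) i. if i \<in> I then g i else 0)"
  have ext_sum: "ext g summable_on UNIV \<longleftrightarrow> g summable_on I" for g
    unfolding ext_def by (rule summable_on_cong_neutral) auto
  have infsum_ext: "infsum g I = suminf (ext g)" if "g summable_on I" for g
  proof -
    have "infsum g I = infsum (ext g) UNIV"
      unfolding ext_def by (rule infsum_cong_neutral) auto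
    also have "\<dots> = suminf (ext g)"
      using that ext_sum by (metis has_sum_imp_sums has_sum_infsum sums_unique)
    finally show ?thesis .
  qed
  have bound_b: "\<bar>b i\<bar> \<le> M i" if "i \<in> I" for i
    using LIMSEQ_le_const2[OF tendsto_rabs[OF lim[OF that]], of "M i"] bound[OF that] by auto
  have sm: "g summable_on I" if "\<And>i. i \<in> I \<Longrightarrow> \<bar>g i\<bar> \<le> M i" for g
    by (rule abs_summable_summable, rule summable_on_comparison_test[OF M]) (use that in auto)
  have "(\<lambda>n. \<Sum>i. ext (\<lambda>i. a i n) i) \<longlonglongrightarrow> (\<Sum>i. ext b i)"
  proof (rule suminf_dominated_convergence[where M = "ext M"])
    show "summable (ext M)" using M ext_sum summable_on_imp_summable by blast
  qed (auto simp: ext_def lim bound)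
  then show ?thesis
    using infsum_ext[OF sm, of b] infsum_ext[OF sm, of "\<lambda>i. a i _"] bound bound_b by simp
qed

section \<open>The renewal theorem\<close>

text \<open>\<open>L\<close> is the limit superior, first taken in the extended reals and then seen
  to be finite because the sequence is bounded. The last conclusion records that no larger cluster
  point exists.\<close>

lemma bounded_limsup_subseq:
  fixes x :: "nat \<Rightarrow> real"
  assumes "\<And>n. \<bar>x n\<bar> \<le> B"
  obtains L s where "strict_mono s" "(\<lambda>n. x (s n)) \<longlonglongrightarrow> L"
    "\<And>e. e > 0 \<Longrightarrow> \<forall>\<^sub>F n in sequentially. x n < L + e"
proof -
  obtain s :: "nat \<Rightarrow> nat" where s: "strict_mono s"
      "((\<lambda>n. ereal (x n)) \<circ> s) \<longlonglongrightarrow> limsup (\<lambda>n. ereal (x n))"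
    using limsup_subseq_lim by blast
  have "limsup (\<lambda>n. ereal (x n)) \<le> ereal B"
    by (rule Limsup_bounded) (use assms abs_le_D1 in \<open>auto simp: eventually_sequentially\<close>)
  moreover have "ereal (- B) \<le> liminf (\<lambda>n. ereal (x n))"
    by (rule Liminf_bounded) (use assms abs_le_D2 minus_le_iff in \<open>force simp: eventually_sequentially\<close>)
  moreover have "liminf (\<lambda>n. ereal (x n)) \<le> limsup (\<lambda>n. ereal (x n))"
    by (rule Liminf_le_Limsup) simp
  ultimately obtain L where L: "limsup (\<lambda>n. ereal (x n)) = ereal L"
    by (cases "limsup (\<lambda>n. ereal (x n))") auto
  show thesis
  proof (rule that[OF s(1), of L])
    show "(\<lambda>n. x (s n)) \<longlonglongrightarrow> L"
      using s(2) L by (simp add: o_def)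
    show "\<forall>\<^sub>F n in sequentially. x n < L + e" if "e > 0" for e
      using Limsup_lessD[of sequentially "\<lambda>n. ereal (x n)" "ereal (L + e)"] L that by simp
  qed
qed

text \<open>The least positive difference \<open>d\<close> of two elements of \<open>D\<close>
  divides every element, so \<open>d = 1\<close> and \<open>D\<close> contains two consecutive
  numbers \<open>b\<close> and \<open>b + 1\<close>. Every \<open>n \<ge> b * b\<close> is a
  combination of these two with natural coefficients.\<close>

lemma add_closed_Gcd_1_eventually:
  fixes D :: "nat set"
  assumes zero: "0 \<in> D" and add: "\<And>a b. a \<in> D \<Longrightarrow> b \<in> D \<Longrightarrow> a + b \<in> D" and gcd: "Gcd D = 1"
  obtains N where "\<And>n. n \<ge> N \<Longrightarrow> n \<in> D"
proof -
  have mult: "q * a \<in> D" if "a \<in> D" for q a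
    by (induction q) (use that zero add in auto)
  have "\<exists>d. d > 0 \<and> (\<exists>a\<in>D. \<exists>b\<in>D. a = b + d)"
  proof (rule ccontr)
    assume "\<not> ?thesis"
    with zero have "D \<subseteq> {0}" by force
    then have "Gcd D = 0" by simp
    with gcd show False by simp
  qed
  then obtain d where d: "d > 0" "\<exists>a\<in>D. \<exists>b\<in>D. a = b + d"
    and dmin: "\<And>d'. d' < d \<Longrightarrow> \<not> (d' > 0 \<and> (\<exists>a\<in>D. \<exists>b\<in>D. a = b + d'))"
    using exists_least_iff[of "\<lambda>d. d > 0 \<and> (\<exists>a\<in>D. \<exists>b\<in>D. a = b + d)"] by metis
  from d obtain a b where ab: "a \<in> D" "b \<in> D" "a = b + d" by blast
  have "d dvd n" if "n \<in> D" for n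
  proof -
    \<comment> \<open>Both sides are built from elements of \<open>D\<close> and differ by
      \<open>n mod d < d\<close>; minimality of \<open>d\<close> forces this remainder to
      vanish.\<close>
    have "n + (n div d) * b = (n div d) * a + n mod d"
      using ab(3) div_mult_mod_eq[of n d] by (simp add: algebra_simps)
    moreover have "n + (n div d) * b \<in> D" "(n div d) * a \<in> D"
      using add mult ab that by auto
    ultimately have "\<not> n mod d > 0"
      using dmin[of "n mod d"] d(1) by (meson mod_less_divisor)
    then show ?thesis by auto
  qed
  then have "d dvd Gcd D" by (rule Gcd_greatest)
  with gcd have "d = 1" by simp
  show thesis
  proof (rule that[of "b * b"])
    fix n assume n: "n \<ge> b * b"
    show "n \<in> D"
    proof (cases "b = 0")
      case True
      then have "1 \<in> D" using ab \<open>d = 1\<close> by simp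
      then show ?thesis using mult[of 1 n] by simp
    next
      case False
      then have "n mod b < b" by simp
      moreover have "b \<le> n div b" using n False
        by (metis div_le_mono nonzero_mult_div_cancel_right)
      ultimately have le: "n mod b \<le> n div b" by simp
      \<comment> \<open>Since \<open>a = b + 1\<close>, using \<open>n mod b\<close> copies of
        \<open>a\<close> in place of \<open>b\<close> produces the remainder. The bound
        \<open>b * b\<close> guarantees that the quotient is large enough for this.\<close>
      have "n = (n div b - n mod b) * b + n mod b * a"
      proof -
        have "(n div b - n mod b) * b + n mod b * a = (n div b - n mod b + n mod b) * b + n mod b"
          using ab(3) \<open>d = 1\<close> by (simp add: algebra_simps)
        with le show ?thesis by simp
      qed
      then show ?thesis using add mult ab by metis
    qed
  qed
qed

text \<open>\<open>f\<close> is the distribution of the waiting time between renewals and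
  \<open>u n\<close> the probability of a renewal at time \<open>n\<close>; \<open>u_Suc\<close>
  conditions on the first waiting time \<open>Suc k\<close>. Aperiodicity is stated in terms of
  \<open>u\<close> because for a Markov chain it is given in terms of the return
  probabilities.\<close>

locale renewal =
  fixes f u :: "nat \<Rightarrow> real"
  assumes f_nonneg: "\<And>n. f n \<ge> 0"
    and f_0: "f 0 = 0"
    and f_sums: "f sums 1"
    and mean_finite: "summable (\<lambda>n. real n * f n)"
    and u_0: "u 0 = 1"
    and u_Suc: "\<And>n. u (Suc n) = (\<Sum>k\<le>n. f (Suc k) * u (n - k))"
    and aperiodic: "Gcd {k. k \<ge> 1 \<and> u k > 0} = 1"
begin

lemma f_Suc_sums: "(\<lambda>n. f (Suc n)) sums 1"
  using f_sums f_0 by (simp add: sums_Suc_iff)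

lemma u_bounds: "0 \<le> u n \<and> u n \<le> 1"
proof (induction n rule: less_induct)
  case (less n)
  show ?case
  proof (cases n)
    case 0
    then show ?thesis by (simp add: u_0)
  next
    case (Suc m)
    have "0 \<le> u n"
      unfolding Suc u_Suc by (intro sum_nonneg mult_nonneg_nonneg f_nonneg) (use less Suc in auto)
    moreover have "u n \<le> (\<Sum>k\<le>m. f (Suc k) * 1)"
      unfolding Suc u_Suc by (intro sum_mono mult_left_mono f_nonneg) (use less Suc in auto)
    moreover have "(\<Sum>k\<le>m. f (Suc k)) \<le> 1"
      using sum_le_suminf[of "\<lambda>n. f (Suc n)" "{..m}"] f_Suc_sums f_nonneg by (auto simp: sums_iff)
    ultimately show ?thesis by simp
  qed
qed

text \<open>The probability that a waiting time exceeds \<open>n\<close>. The sum of all tails is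
  the mean waiting time, so \<open>1 / suminf tail\<close> is the limit expected from the renewal
  theorem.\<close>

definition tail :: "nat \<Rightarrow> real" where
  "tail n = (\<Sum>k. if n < k then f k else 0)"

lemma summable_tail_terms: "summable (\<lambda>k. if n < k then f k else 0)"
  by (rule summable_comparison_test'[of f 0]) (use f_sums f_nonneg in \<open>auto simp: sums_iff\<close>)

lemma tail_nonneg: "tail n \<ge> 0"
  unfolding tail_def by (rule suminf_nonneg[OF summable_tail_terms]) (use f_nonneg in auto)

lemma tail_0: "tail 0 = 1"
proof -
  have "(\<lambda>k. if 0 < k then f k else 0) = f" using f_0 by auto
  then show ?thesis using f_sums by (simp add: tail_def sums_iff)
qed

lemma tail_Suc: "tail (Suc n) = tail n - f (Suc n)"
proof -
  have "tail n - tail (Suc n) = (\<Sum>k. (if n < k then f k else 0) - (if Suc n < k then f k else 0))"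
    unfolding tail_def by (rule suminf_diff[OF summable_tail_terms summable_tail_terms])
  also have "\<dots> = (\<Sum>k. if k = Suc n then f k else 0)"
    by (rule suminf_cong) auto
  also have "\<dots> = f (Suc n)"
    using suminf_finite[of "{Suc n}" "\<lambda>k. if k = Suc n then f k else 0"] by simp
  finally show ?thesis by simp
qed

text \<open>After exchanging the sums, \<open>f k\<close> is counted once for each
  \<open>n < k\<close>, hence at most \<open>k\<close> times, and the finite mean bounds the partial
  sums.\<close>

lemma summable_tail: "summable tail"
proof (rule bounded_imp_summable[where B = "\<Sum>n. real n * f n"])
  fix N
  have "(\<Sum>n\<le>N. tail n) = (\<Sum>k. \<Sum>n\<le>N. if n < k then f k else 0)"
    unfolding tail_def by (rule suminf_sum[symmetric]) (rule summable_tail_terms)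
  also have "\<dots> \<le> (\<Sum>k. real k * f k)"
  proof (rule suminf_le)
    fix k
    have "(\<Sum>n\<le>N. if n < k then f k else 0) = (\<Sum>n\<in>{n\<in>{..N}. n < k}. f k)"
      by (rule sum.inter_filter[symmetric]) simp
    also have "\<dots> = real (card {n\<in>{..N}. n < k}) * f k" by simp
    also have "card {n\<in>{..N}. n < k} \<le> card {..<k}" by (rule card_mono) auto
    then have "real (card {n\<in>{..N}. n < k}) * f k \<le> real k * f k"
      using f_nonneg by (intro mult_right_mono) auto
    finally show "(\<Sum>n\<le>N. if n < k then f k else 0) \<le> real k * f k" .
  qed (auto intro!: summable_sum summable_tail_terms mean_finite)
  finally show "(\<Sum>n\<le>N. tail n) \<le> (\<Sum>n. real n * f n)" .
qed (rule tail_nonneg)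

lemma suminf_tail_ge_1: "1 \<le> suminf tail"
  using sum_le_suminf[OF summable_tail, of "{0}"] tail_nonneg tail_0 by auto

text \<open>The last renewal before time \<open>n\<close> happens at exactly one of the times \<open>0, \<dots>, n\<close>.\<close>

lemma sum_tail_u: "(\<Sum>k\<le>n. tail k * u (n - k)) = 1"
proof (induction n)
  case 0
  then show ?case by (simp add: tail_0 u_0)
next
  case (Suc n)
  have "(\<Sum>k\<le>Suc n. tail k * u (Suc n - k)) = u (Suc n) + (\<Sum>k\<le>n. tail (Suc k) * u (n - k))"
    by (subst sum.atMost_Suc_shift) (simp add: tail_0)
  also have "\<dots> = (\<Sum>k\<le>n. tail k * u (n - k))"
    by (simp add: u_Suc tail_Suc left_diff_distrib sum_subtractf)
  finally show ?case using Suc by simp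
qed

lemma summable_f_Suc_times:
  assumes "\<And>n. \<bar>v n\<bar> \<le> B"
  shows "summable (\<lambda>n. f (Suc n) * v n)"
proof (rule summable_comparison_test'[of "\<lambda>n. f (Suc n) * B" 0])
  show "summable (\<lambda>n. f (Suc n) * B)"
    using f_Suc_sums by (simp add: sums_iff summable_mult2)
  show "norm (f (Suc n) * v n) \<le> f (Suc n) * B" for n
    using assms[of n] f_nonneg by (auto simp: abs_mult intro!: mult_left_mono)
qed

text \<open>The shifts that preserve the set where \<open>v\<close> attains its maximum form an additive monoid that
  contains every \<open>k\<close> with \<open>u k > 0\<close>, so by aperiodicity it contains all large numbers.\<close>

lemma backward_renewal_max:
  assumes bound: "\<And>n. \<bar>v n\<bar> \<le> B"
    and eq: "\<And>m. v m = (\<Sum>n. f (Suc n) * v (m + Suc n))"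
    and max: "\<And>m. v m \<le> v 0"
  obtains N where "\<And>n. n \<ge> N \<Longrightarrow> v n = v 0"
proof -
  define D where "D = {k. \<forall>m. v m = v 0 \<longrightarrow> v (m + k) = v 0}"
  have step: "k \<in> D" if "f k > 0" for k
    unfolding D_def
  proof (safe)
    fix m assume m: "v m = v 0"
    obtain l where l: "k = Suc l" using \<open>f k > 0\<close> f_0 by (cases k) auto
    have s: "summable (\<lambda>n. f (Suc n) * v (m + Suc n))" "summable (\<lambda>n. f (Suc n) * v 0)"
      by (rule summable_f_Suc_times[of _ B], rule bound)+
    have sd: "summable (\<lambda>n. f (Suc n) * v 0 - f (Suc n) * v (m + Suc n))"
      by (rule summable_diff[OF s(2,1)])
    have "(\<Sum>n. f (Suc n) * v 0 - f (Suc n) * v (m + Suc n)) = v 0 - v m"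
      \<comment> \<open>The weights \<open>f (Suc n)\<close> sum to 1, so \<open>v 0 - v m\<close>
        is a weighted sum of the differences \<open>v 0 - v (m + Suc n)\<close>. These are
        non-negative by maximality, so at a point where \<open>v m = v 0\<close> every term
        vanishes.\<close>
      using suminf_diff[OF s(2,1)] eq[of m] f_Suc_sums s(2)
      by (simp add: suminf_mult2[symmetric] sums_iff)
    with m have "(\<Sum>n. f (Suc n) * v 0 - f (Suc n) * v (m + Suc n)) = 0" by simp
    moreover have "f (Suc n) * v 0 - f (Suc n) * v (m + Suc n) \<ge> 0" for n
      using max f_nonneg by (simp add: mult_left_mono)
    ultimately have "f k * v 0 - f k * v (m + k) = 0"
      unfolding l using suminf_eq_zero_iff[OF sd] by blast
    with that show "v (m + k) = v 0" by simp
  qed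
  have add: "a + b \<in> D" if "a \<in> D" "b \<in> D" for a b
    using that by (auto simp: D_def simp flip: add.assoc)
  have zero: "0 \<in> D" by (simp add: D_def)
  have sub: "k \<in> D" if "u k > 0" for k
    using that
  proof (induction k rule: less_induct)
    case (less k)
    show ?case
    proof (cases k)
      case (Suc m)
      \<comment> \<open>A renewal at time \<open>k\<close> splits into a possible first waiting time
        \<open>Suc i\<close> and a possible renewal \<open>m - i\<close> steps later; both shifts
        lie in \<open>D\<close>, and so does their sum.\<close>
      have "\<exists>i\<le>m. f (Suc i) * u (m - i) > 0"
      proof (rule ccontr)
        assume "\<not> ?thesis"
        then have "u k \<le> 0" unfolding Suc u_Suc by (intro sum_nonpos) (auto simp: not_less)
        with less.prems show False by simp
      qed
      then obtain i where i: "i \<le> m" "f (Suc i) > 0" "u (m - i) > 0"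
        using f_nonneg u_bounds by (metis zero_less_mult_pos zero_less_mult_pos2 mult_zero_left order.order_iff_strict mult_eq_0_iff)
      then have "Suc i + (m - i) \<in> D"
        using less.IH[of "m - i"] Suc step[of "Suc i"] add[of "Suc i" "m - i"] by auto
      with i Suc show ?thesis by simp
    qed (simp add: zero)
  qed
  have "Gcd D dvd Gcd {k. k \<ge> 1 \<and> u k > 0}"
    by (rule Gcd_greatest) (auto intro: Gcd_dvd sub)
  then have "Gcd D = 1" using aperiodic by simp
  from add_closed_Gcd_1_eventually[OF zero add this] obtain N
    where N: "\<And>n. n \<ge> N \<Longrightarrow> n \<in> D" by blast
  show thesis
  proof (rule that)
    fix n assume "n \<ge> N"
    then have "n \<in> D" by (rule N)
    then show "v n = v 0" by (auto simp: D_def)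
  qed
qed

text \<open>The sign \<open>\<sigma>\<close> treats the limit superior and the limit inferior at
  once. Along a refined subsequence all backward shifts of \<open>u\<close> converge to a sequence
  \<open>v\<close>; extremality makes \<open>\<sigma> * v\<close> maximal at 0, hence eventually
  constant, and the limit of \<open>sum_tail_u\<close> gives its value.\<close>

lemma extremal_cluster_point:
  fixes \<sigma> :: real
  assumes s: "strict_mono s" and lim: "(\<lambda>n. \<sigma> * u (s n)) \<longlonglongrightarrow> L"
    and \<sigma>: "\<bar>\<sigma>\<bar> = 1"
    and sup: "\<And>e. e > 0 \<Longrightarrow> \<forall>\<^sub>F n in sequentially. \<sigma> * u n < L + e"
  shows "\<sigma> * L * suminf tail = 1"
proof -
  have \<sigma>2: "\<sigma> * \<sigma> = 1" using \<sigma> by (metis abs_mult_self_eq mult_1)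
  \<comment> \<open>Cantor's diagonal argument: requirement number \<open>m\<close> is the
    convergence of the sequence shifted back by \<open>m\<close>, and each can be met by thinning
    out a given subsequence.\<close>
  interpret subseqs "\<lambda>m r. convergent (\<lambda>k. u (s (r k) - m))"
  proof
    fix m and r :: "nat \<Rightarrow> nat"
    have "bounded (range (\<lambda>k. u (s (r k) - m)))"
      unfolding bounded_iff by (rule exI[of _ 1]) (use u_bounds in auto)
    from bounded_imp_convergent_subsequence[OF this]
    obtain l r' where "strict_mono r'" "((\<lambda>k. u (s (r k) - m)) \<circ> r') \<longlonglongrightarrow> l" by blast
    then show "\<exists>r'. strict_mono r' \<and> convergent (\<lambda>k. u (s ((r \<circ> r') k) - m))"
      by (auto simp: convergent_def o_def)
  qed
  have conv_v: "convergent (\<lambda>k. u (s (diagseq k) - m))" for m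
  proof -
    \<comment> \<open>The diagonal sequence refines the \<open>m\<close>-th subsequence only from
      index \<open>Suc m\<close> on, which is enough for convergence.\<close>
    have "convergent (\<lambda>k. u (s ((diagseq \<circ> (+) (Suc m)) k) - m))"
    proof (rule diagseq_holds)
      fix r q :: "nat \<Rightarrow> nat" and n
      assume "strict_mono r" "convergent (\<lambda>k. u (s (q k) - n))"
      from convergent_subseq_convergent[OF this(2,1)]
      show "convergent (\<lambda>k. u (s ((q \<circ> r) k) - n))" by (simp add: o_def)
    qed
    then have "convergent (\<lambda>k. u (s (diagseq (k + Suc m)) - m))" by (simp add: add.commute)
    then show ?thesis
      using convergent_ignore_initial_segment[of "\<lambda>k. u (s (diagseq k) - m)" "Suc m"] by simp
  qed
  define v where "v = (\<lambda>m. lim (\<lambda>k. u (s (diagseq k) - m)))"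
  have v: "(\<lambda>k. u (s (diagseq k) - m)) \<longlonglongrightarrow> v m" for m
    unfolding v_def using conv_v[of m] by (simp add: convergent_LIMSEQ_iff)
  define t where "t = s \<circ> diagseq"
  have t: "strict_mono t" unfolding t_def by (intro strict_mono_o s subseq_diagseq)
  have ev_t: "\<forall>\<^sub>F k in sequentially. N \<le> t k" for N
    using filterlim_subseq[OF t] by (auto simp: filterlim_at_top)
  have v_bounds: "0 \<le> v m \<and> v m \<le> 1" for m
    using LIMSEQ_le_const[OF v[of m], of 0] LIMSEQ_le_const2[OF v[of m], of 1] u_bounds by auto
  then have v_abs: "\<bar>\<sigma> * v m\<bar> \<le> 1" for m using \<sigma> by (simp add: abs_mult)
  have "(\<lambda>k. \<sigma> * u (s (diagseq k))) \<longlonglongrightarrow> L"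
    using LIMSEQ_subseq_LIMSEQ[OF lim subseq_diagseq] by (simp add: o_def)
  moreover have "(\<lambda>k. \<sigma> * u (s (diagseq k))) \<longlonglongrightarrow> \<sigma> * v 0"
    using v[of 0] by (auto intro: tendsto_mult_left)
  ultimately have L: "\<sigma> * v 0 = L" by (rule LIMSEQ_unique[rotated])
  \<comment> \<open>Each \<open>v m\<close> is again a cluster value of \<open>u\<close>, while
    \<open>\<sigma> * v 0\<close> is the extremal one.\<close>
  have max: "\<sigma> * v m \<le> \<sigma> * v 0" for m
    unfolding L
  proof (rule field_le_epsilon)
    fix e :: real assume "e > 0"
    then obtain N where N: "\<And>n. n \<ge> N \<Longrightarrow> \<sigma> * u n < L + e"
      using sup unfolding eventually_sequentially by blast
    have "\<forall>\<^sub>F k in sequentially. \<sigma> * u (t k - m) \<le> L + e"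
      using ev_t[of "N + m"] by eventually_elim (rule less_imp_le[OF N], simp)
    moreover have "(\<lambda>k. \<sigma> * u (t k - m)) \<longlonglongrightarrow> \<sigma> * v m"
      unfolding t_def using v[of m] by (auto intro: tendsto_mult_left)
    ultimately show "\<sigma> * v m \<le> L + e"
      by (intro tendsto_upperbound[of "\<lambda>k. \<sigma> * u (t k - m)" "\<sigma> * v m" sequentially]) simp_all
  qed
  \<comment> \<open>One limit for two uses: \<open>d = 0\<close> with the weights
    \<open>f (Suc n)\<close> for the renewal equation, and \<open>d = 1\<close> with the weights
    \<open>tail n\<close> for \<open>sum_tail_u\<close>. The truncated subtractions are genuine as
    soon as \<open>t k \<ge> m + Suc n\<close>.\<close>
  have conv: "(\<lambda>k. \<Sum>n. if n < t k - m then g n * u (t k - m - Suc n + d) else 0)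
      \<longlonglongrightarrow> (\<Sum>n. g n * v (m + Suc n - d))"
    if g: "summable g" "\<And>n. g n \<ge> 0" and d: "d \<le> 1" for g :: "nat \<Rightarrow> real" and m d
  proof (rule suminf_dominated_convergence[of _ _ g])
    fix n
    have "(\<lambda>k. g n * u (t k - (m + Suc n - d))) \<longlonglongrightarrow> g n * v (m + Suc n - d)"
      unfolding t_def using v by (auto intro: tendsto_mult_left)
    moreover have "\<forall>\<^sub>F k in sequentially. g n * u (t k - (m + Suc n - d)) =
        (if n < t k - m then g n * u (t k - m - Suc n + d) else 0)"
      using ev_t[of "m + Suc n"]
    proof eventually_elim
      case (elim k)
      then have "t k - (m + Suc n - d) = t k - m - Suc n + d" "n < t k - m" using d by auto
      then show ?case by simp
    qed
    ultimately show "(\<lambda>k. if n < t k - m then g n * u (t k - m - Suc n + d) else 0)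
        \<longlonglongrightarrow> g n * v (m + Suc n - d)"
      by (rule Lim_transform_eventually)
  qed (use g u_bounds in \<open>auto simp: abs_mult intro: mult_left_le\<close>)
  have fin: "(\<Sum>n. if n < Suc N then g n else 0) = (\<Sum>n\<le>N. g n)" for g :: "nat \<Rightarrow> real" and N
  proof -
    have "(\<Sum>n. if n < Suc N then g n else 0) = (\<Sum>n\<in>{..N}. if n < Suc N then g n else 0)"
      by (rule suminf_finite) auto
    also have "\<dots> = (\<Sum>n\<le>N. g n)" by (rule sum.cong) auto
    finally show ?thesis .
  qed
  have eq: "v m = (\<Sum>n. f (Suc n) * v (m + Suc n))" for m
  proof -
    have "(\<lambda>k. \<Sum>n. if n < t k - m then f (Suc n) * u (t k - m - Suc n + 0) else 0)
        \<longlonglongrightarrow> (\<Sum>n. f (Suc n) * v (m + Suc n - 0))"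
      by (rule conv) (use f_Suc_sums f_nonneg in \<open>auto simp: sums_iff\<close>)
    moreover have "\<forall>\<^sub>F k in sequentially.
        (\<Sum>n. if n < t k - m then f (Suc n) * u (t k - m - Suc n + 0) else 0) = u (t k - m)"
      using ev_t[of "Suc m"]
    proof eventually_elim
      case (elim k)
      then obtain N where N: "t k - m = Suc N" by (metis Suc_diff_le diff_Suc_Suc)
      show ?case unfolding N fin u_Suc by (intro sum.cong) auto
    qed
    ultimately have "(\<lambda>k. u (t k - m)) \<longlonglongrightarrow> (\<Sum>n. f (Suc n) * v (m + Suc n))"
      by (auto intro: Lim_transform_eventually)
    with v[of m] show ?thesis unfolding t_def by (auto intro: LIMSEQ_unique)
  qed
  have sum1: "(\<Sum>n. tail n * v (m + n)) = 1" for m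
  proof -
    have A: "(\<lambda>k. \<Sum>n. if n < t k - m then tail n * u (t k - m - Suc n + 1) else 0)
        \<longlonglongrightarrow> (\<Sum>n. tail n * v (m + Suc n - 1))"
      by (rule conv) (auto intro: summable_tail tail_nonneg)
    \<comment> \<open>The truncated series stops just before the term
      \<open>tail (t k - m) * u 0\<close> of \<open>sum_tail_u\<close>. This missing term accounts
      for the difference from 1, and it tends to 0.\<close>
    have ev: "\<forall>\<^sub>F k in sequentially.
        (\<Sum>n. if n < t k - m then tail n * u (t k - m - Suc n + 1) else 0) = 1 - tail (t k - m)"
      using ev_t[of "Suc m"]
    proof eventually_elim
      case (elim k)
      then obtain N where N: "t k - m = Suc N" by (metis Suc_diff_le diff_Suc_Suc)
      have "(\<Sum>n\<le>N. tail n * u (Suc N - Suc n + 1)) = (\<Sum>n\<le>N. tail n * u (Suc N - n))"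
        by (rule sum.cong) (auto simp: Suc_diff_le)
      also have "\<dots> = 1 - tail (Suc N)"
        using sum_tail_u[of "Suc N"] by (simp add: u_0)
      finally show ?case unfolding N fin .
    qed
    have lim1: "(\<lambda>k. 1 - tail (t k - m)) \<longlonglongrightarrow> 1 - 0"
    proof (intro tendsto_intros)
      have "filterlim (\<lambda>k. t k - m) at_top sequentially"
        unfolding filterlim_at_top
      proof
        fix Z show "\<forall>\<^sub>F k in sequentially. Z \<le> t k - m"
          using ev_t[of "Z + m"] by eventually_elim simp
      qed
      then show "(\<lambda>k. tail (t k - m)) \<longlonglongrightarrow> 0"
        by (rule filterlim_compose[OF summable_LIMSEQ_zero[OF summable_tail]])
    qed
    show ?thesis
      using LIMSEQ_unique[OF Lim_transform_eventually[OF A ev] lim1] by simp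
  qed
  have eq_\<sigma>: "\<sigma> * v m = (\<Sum>n. f (Suc n) * (\<sigma> * v (m + Suc n)))" for m
  proof -
    have "summable (\<lambda>n. f (Suc n) * v (m + Suc n))"
      by (rule summable_f_Suc_times[of _ 1]) (use v_bounds in auto)
    from suminf_mult[OF this, of \<sigma>] eq[of m] show ?thesis
      by (simp add: mult.left_commute)
  qed
  from backward_renewal_max[of "\<lambda>n. \<sigma> * v n", OF v_abs eq_\<sigma> max]
  obtain N where N: "\<And>n. n \<ge> N \<Longrightarrow> \<sigma> * v n = \<sigma> * v 0" by metis
  \<comment> \<open>From \<open>N\<close> on \<open>v\<close> is the constant \<open>v 0\<close>, so
    the identity \<open>sum1\<close> at \<open>m = N\<close> determines it.\<close>
  have "v n = v 0" if "n \<ge> N" for n using N[OF that] \<sigma> by auto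
  then have "(\<Sum>n. tail n * v 0) = 1" using sum1[of N] by simp
  then have "suminf tail * v 0 = 1" using suminf_mult2[OF summable_tail, of "v 0"] by simp
  then show ?thesis using L \<sigma>2 by (auto simp: algebra_simps)
qed

text \<open>The signs 1 and -1 in \<open>extremal_cluster_point\<close> show that the limit superior
  and the limit inferior of \<open>u\<close> both equal \<open>1 / suminf tail\<close>.\<close>

theorem renewal_limit: "u \<longlonglongrightarrow> 1 / suminf tail"
proof -
  have R: "suminf tail > 0" using suminf_tail_ge_1 by simp
  have key: "\<forall>\<^sub>F n in sequentially. \<sigma> * u n < \<sigma> / suminf tail + e"
    if \<sigma>: "\<bar>\<sigma>\<bar> = 1" and "e > 0" for \<sigma> e
  proof -
    have "\<bar>\<sigma> * u n\<bar> \<le> 1" for n using \<sigma> u_bounds[of n] by (simp add: abs_mult)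
    from bounded_limsup_subseq[of "\<lambda>n. \<sigma> * u n", OF this]
    obtain L s where L: "strict_mono s" "(\<lambda>n. \<sigma> * u (s n)) \<longlonglongrightarrow> L"
      "\<And>e. e > 0 \<Longrightarrow> \<forall>\<^sub>F n in sequentially. \<sigma> * u n < L + e" by metis
    from extremal_cluster_point[OF L(1,2) \<sigma> L(3)] have "\<sigma> * L * suminf tail = 1" .
    moreover have "\<sigma> * \<sigma> = 1" using \<sigma> by (metis abs_mult_self_eq mult_1)
    ultimately have "L = \<sigma> / suminf tail"
      using R by (metis divide_divide_eq_right mult.assoc mult.left_commute mult_1 mult_cancel_left1 nonzero_eq_divide_eq order_less_irrefl)
    with L(3) \<open>e > 0\<close> show ?thesis by simp
  qed
  show ?thesis
  proof (rule tendstoI)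
    fix e :: real assume "e > 0"
    with key[of 1 e] key[of "-1" e]
    have "\<forall>\<^sub>F n in sequentially. 1 * u n < 1 / suminf tail + e"
      "\<forall>\<^sub>F n in sequentially. -1 * u n < -1 / suminf tail + e" by simp_all
    then show "\<forall>\<^sub>F n in sequentially. dist (u n) (1 / suminf tail) < e"
      by eventually_elim (simp add: dist_real_def abs_less_iff)
  qed
qed

lemma renewal_limit_pos: "1 / suminf tail > 0"
  using suminf_tail_ge_1 by simp

end

section \<open>Convergence of Markov chains\<close>

locale stochastic_matrix =
  fixes I :: "nat set" and p :: "nat \<Rightarrow> nat \<Rightarrow> real"
  assumes p_nonneg: "\<And>i j. i \<in> I \<Longrightarrow> j \<in> I \<Longrightarrow> 0 \<le> p i j"
    and p_has_sum: "\<And>i. i \<in> I \<Longrightarrow> (p i has_sum 1) I"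
begin

lemma summable_p: "i \<in> I \<Longrightarrow> p i summable_on I"
  using p_has_sum has_sum_imp_summable by blast

lemma infsum_p: "i \<in> I \<Longrightarrow> infsum (p i) I = 1"
  using p_has_sum infsumI by blast

lemma summable_p_mult:
  assumes "i \<in> I" "J \<subseteq> I" "\<And>j. j \<in> J \<Longrightarrow> \<bar>g j\<bar> \<le> B"
  shows "(\<lambda>j. p i j * g j) summable_on J"
proof (rule abs_summable_summable, rule summable_on_comparison_test)
  show "(\<lambda>j. p i j * B) summable_on J"
    using summable_on_subset_banach[OF summable_p[OF assms(1)] assms(2)] by (rule summable_on_cmult_left)
  show "norm (p i j * g j) \<le> p i j * B" if "j \<in> J" for j
    using that assms p_nonneg[of i j] by (auto simp: abs_mult subset_iff intro!: mult_left_mono)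
qed auto

section \<open>Powers of a stochastic matrix and first passages\<close>

lemma matpow_bounds:
  assumes "i \<in> I" "j \<in> I"
  shows "0 \<le> matpow I p k i j \<and> matpow I p k i j \<le> 1"
  using assms(1)
proof (induction k arbitrary: i)
  case (Suc k)
  have "0 \<le> matpow I p (Suc k) i j"
    using Suc p_nonneg by (auto intro!: infsum_nonneg)
  moreover have "matpow I p (Suc k) i j \<le> infsum (p i) I"
    unfolding matpow.simps
  proof (rule infsum_mono)
    show "(\<lambda>l. p i l * matpow I p k l j) summable_on I"
      using Suc by (intro summable_p_mult[of _ _ _ 1]) auto
    show "p i l * matpow I p k l j \<le> p i l" if "l \<in> I" for l
      using Suc that p_nonneg by (auto intro!: mult_left_le)
  qed (use Suc summable_p in auto)
  ultimately show ?case using infsum_p Suc by simp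
qed auto

lemma summable_p_matpow:
  assumes "i \<in> I" "j \<in> I" "J \<subseteq> I"
  shows "(\<lambda>l. p i l * matpow I p k l j) summable_on J"
  using assms matpow_bounds by (intro summable_p_mult[of _ _ _ 1]) (auto simp: subset_iff)

text \<open>First passages at different times are disjoint events. The sum is bounded by induction
  on the time horizon: the first step either hits \<open>j\<close>, with probability
  \<open>p i j\<close>, or leads to some other \<open>l\<close>, from where the bound 1 applies
  again.\<close>

lemma first_passage_bounds:
  assumes "i \<in> I" "j \<in> I"
  shows "(\<forall>k. 0 \<le> first_passage I p k i j) \<and> (\<Sum>k\<le>n. first_passage I p (Suc k) i j) \<le> 1"
proof -
  have split: "infsum g I = g j + infsum g (I - {j})" if "g summable_on (I - {j})" for g :: "nat \<Rightarrow> real"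
    using infsum_insert[of g "I - {j}" j] that assms(2) by (simp add: insert_absorb)
  have nonneg: "0 \<le> first_passage I p k i j" if "i \<in> I" for k i
    using that
  proof (induction k arbitrary: i rule: less_induct)
    case (less k)
    consider "k = 0" | "k = Suc 0" | n where "k = Suc (Suc n)"
      by (metis not0_implies_Suc)
    then show ?case
      by cases (use less p_nonneg assms in \<open>auto intro!: infsum_nonneg mult_nonneg_nonneg\<close>)
  qed
  have "(\<Sum>k\<le>n. first_passage I p (Suc k) i j) \<le> 1" if "i \<in> I" for n i
    using that
  proof (induction n arbitrary: i)
    case 0
    then show ?case
      using split[OF summable_on_subset_banach[OF summable_p]] infsum_p[of i]
        infsum_nonneg[of "I - {j}" "p i"] p_nonneg by force
  next
    case (Suc n)
    have le1: "first_passage I p (Suc k) l j \<le> 1" if "k \<le> n" "l \<in> I" for k l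
    proof -
      have "first_passage I p (Suc k) l j \<le> (\<Sum>k\<le>n. first_passage I p (Suc k) l j)"
        by (rule member_le_sum) (use that nonneg in auto)
      with Suc.IH[of l] that show ?thesis by simp
    qed
    have sm: "(\<lambda>l. p i l * first_passage I p (Suc k) l j) summable_on (I - {j})" if "k \<le> n" for k
      using that Suc.prems nonneg le1 by (intro summable_p_mult[of _ _ _ 1]) auto
    have "(\<Sum>k\<le>n. first_passage I p (Suc (Suc k)) i j)
        = (\<Sum>\<^sub>\<infinity>l\<in>I - {j}. \<Sum>k\<le>n. p i l * first_passage I p (Suc k) l j)"
      by (subst infsum_sum) (auto simp: sm)
    also have "\<dots> \<le> infsum (p i) (I - {j})"
    proof (rule infsum_mono)
      show "(\<lambda>l. \<Sum>k\<le>n. p i l * first_passage I p (Suc k) l j) summable_on (I - {j})"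
        by (rule summable_on_sum) (auto simp: sm)
      show "p i summable_on (I - {j})"
        by (rule summable_on_subset_banach[OF summable_p]) (use Suc.prems in auto)
      show "(\<Sum>k\<le>n. p i l * first_passage I p (Suc k) l j) \<le> p i l" if "l \<in> I - {j}" for l
        using that Suc p_nonneg by (auto simp flip: sum_distrib_left intro!: mult_left_le)
    qed
    finally have "(\<Sum>k\<le>n. first_passage I p (Suc (Suc k)) i j) \<le> infsum (p i) (I - {j})" .
    moreover have "infsum (p i) I = p i j + infsum (p i) (I - {j})"
      by (rule split, rule summable_on_subset_banach[OF summable_p]) (use Suc.prems in auto)
    ultimately have "p i j + (\<Sum>k\<le>n. first_passage I p (Suc (Suc k)) i j) \<le> 1"
      using infsum_p[OF Suc.prems] by simp
    then show ?case by (subst sum.atMost_Suc_shift) simp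
  qed
  with nonneg assms show ?thesis by blast
qed

lemma first_passage_le_1:
  assumes "i \<in> I" "j \<in> I"
  shows "first_passage I p (Suc k) i j \<le> 1"
proof -
  have "first_passage I p (Suc k) i j \<le> (\<Sum>k\<le>k. first_passage I p (Suc k) i j)"
    by (rule member_le_sum) (use first_passage_bounds[OF assms] in auto)
  with first_passage_bounds[OF assms, of k] show ?thesis by simp
qed

lemma matpow_Suc_0:
  assumes "i \<in> I" "j \<in> I"
  shows "matpow I p (Suc 0) i j = p i j"
proof -
  have "matpow I p (Suc 0) i j = (\<Sum>\<^sub>\<infinity>l\<in>{j}. p i l * (if l = j then 1 else 0))"
    unfolding matpow.simps by (rule infsum_cong_neutral) (use assms in auto)
  then show ?thesis by simp
qed

text \<open>Decomposition by the first time at which \<open>j\<close> is reached. In the induction a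
  first step into \<open>j\<close> gives the term \<open>k = 0\<close>, and a first step elsewhere
  delays the first passage by one. For \<open>i = j\<close> this is the renewal equation.\<close>

lemma matpow_first_passage:
  assumes "i \<in> I" "j \<in> I"
  shows "matpow I p (Suc n) i j = (\<Sum>k\<le>n. first_passage I p (Suc k) i j * matpow I p (n - k) j j)"
  using assms(1)
proof (induction n arbitrary: i)
  case 0
  then show ?case using matpow_Suc_0[OF 0 assms(2)] by simp
next
  case (Suc n)
  have sm: "(\<lambda>l. p i l * (first_passage I p (Suc k) l j * matpow I p (n - k) j j)) summable_on (I - {j})" for k
    using Suc.prems first_passage_bounds first_passage_le_1 matpow_bounds assms(2)
    by (intro summable_p_mult[of _ _ _ 1]) (auto simp: abs_mult intro!: mult_le_one)
  have "matpow I p (Suc (Suc n)) i j = (\<Sum>\<^sub>\<infinity>l\<in>insert j (I - {j}). p i l * matpow I p (Suc n) l j)"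
    using assms(2) by (simp only: matpow.simps(2)[of I p "Suc n"] insert_Diff)
  also have "\<dots> = p i j * matpow I p (Suc n) j j + (\<Sum>\<^sub>\<infinity>l\<in>I - {j}. p i l * matpow I p (Suc n) l j)"
    by (rule infsum_insert) (use Suc.prems assms summable_p_matpow in \<open>auto simp del: matpow.simps\<close>)
  also have "(\<Sum>\<^sub>\<infinity>l\<in>I - {j}. p i l * matpow I p (Suc n) l j)
      = (\<Sum>\<^sub>\<infinity>l\<in>I - {j}. \<Sum>k\<le>n. p i l * (first_passage I p (Suc k) l j * matpow I p (n - k) j j))"
    by (rule infsum_cong) (simp only: Suc.IH DiffD1 sum_distrib_left)
  also have "\<dots> = (\<Sum>k\<le>n. \<Sum>\<^sub>\<infinity>l\<in>I - {j}. p i l * (first_passage I p (Suc k) l j * matpow I p (n - k) j j))"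
    by (rule infsum_sum) (rule sm)
  also have "\<dots> = (\<Sum>k\<le>n. first_passage I p (Suc (Suc k)) i j * matpow I p (n - k) j j)"
    by (rule sum.cong) (simp_all add: infsum_cmult_left' flip: mult.assoc)
  finally show ?case
    by (subst sum.atMost_Suc_shift) simp
qed

text \<open>Maximum principle: an average that equals an upper bound of the averaged values forces
  equality wherever the weight is positive.\<close>

lemma infsum_p_diff_eq_0:
  assumes "i \<in> I" "l \<in> I" "p i l > 0"
    and "\<And>j. j \<in> I \<Longrightarrow> 0 \<le> g j \<and> g j \<le> c" and "(\<Sum>\<^sub>\<infinity>j\<in>I. p i j * g j) = c"
  shows "g l = c"
proof -
  have sm: "(\<lambda>j. p i j * g j) summable_on I"
    using assms by (intro summable_p_mult[of _ _ _ c]) auto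
  have smc: "(\<lambda>j. p i j * c) summable_on I"
    using assms summable_p by (intro summable_on_cmult_left) auto
  have "(\<Sum>\<^sub>\<infinity>j\<in>I. p i j * c - p i j * g j) = 0"
    using infsum_diff[OF smc sm] assms infsum_p[of i] by (simp add: infsum_cmult_left')
  moreover have "(\<lambda>j. p i j * c - p i j * g j) summable_on I"
    by (rule summable_on_diff[OF smc sm])
  ultimately have "p i l * c - p i l * g l = 0"
    using assms p_nonneg
    by (intro nonneg_infsum_le_0D[of "\<lambda>j. p i j * c - p i j * g j" I]) (auto intro: mult_left_mono)
  with assms show ?thesis by simp
qed

text \<open>The Chapman-Kolmogorov equation with the intermediate state confined to a finite set.
  The resulting inequality involves only a finite outer sum, so limits in \<open>k\<close> can be
  taken term by term.\<close>

lemma matpow_add_ge: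
  assumes "i \<in> I" "j \<in> I" "finite F" "F \<subseteq> I"
  shows "(\<Sum>l\<in>F. matpow I p k i l * matpow I p n l j) \<le> matpow I p (k + n) i j"
  using assms(1)
proof (induction k arbitrary: i)
  case 0
  have "(\<Sum>l\<in>F. matpow I p 0 i l * matpow I p n l j) = (if i \<in> F then matpow I p n i j else 0)"
    using assms(3) by (simp add: if_distrib[of "\<lambda>x. x * _"] cong: if_cong)
  with 0 matpow_bounds assms show ?case by auto
next
  case (Suc k)
  have sm: "(\<lambda>r. p i r * (matpow I p k r l * matpow I p n l j)) summable_on I" if "l \<in> F" for l
    using Suc.prems assms that matpow_bounds
    by (intro summable_p_mult[of _ _ _ 1]) (auto simp: abs_mult subset_iff intro!: mult_le_one)
  have "(\<Sum>l\<in>F. matpow I p (Suc k) i l * matpow I p n l j)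
      = (\<Sum>l\<in>F. \<Sum>\<^sub>\<infinity>r\<in>I. p i r * (matpow I p k r l * matpow I p n l j))"
    by (simp add: infsum_cmult_left' flip: mult.assoc)
  also have "\<dots> = (\<Sum>\<^sub>\<infinity>r\<in>I. \<Sum>l\<in>F. p i r * (matpow I p k r l * matpow I p n l j))"
    by (rule infsum_sum[symmetric]) (rule sm)
  also have "\<dots> \<le> (\<Sum>\<^sub>\<infinity>r\<in>I. p i r * matpow I p (k + n) r j)"
    using Suc assms p_nonneg
    by (intro infsum_mono summable_on_sum sm summable_p_matpow)
      (auto simp flip: sum_distrib_left intro!: mult_left_mono)
  finally show ?case by simp
qed

lemma sum_matpow_le_1:
  assumes "i \<in> I" "finite F" "F \<subseteq> I"
  shows "(\<Sum>j\<in>F. matpow I p k i j) \<le> 1"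
  using assms(1)
proof (induction k arbitrary: i)
  case 0
  then show ?case using assms by simp
next
  case (Suc k)
  have sm: "(\<lambda>l. p i l * matpow I p k l j) summable_on I" if "j \<in> F" for j
    using Suc.prems assms that by (intro summable_p_matpow) auto
  have "(\<Sum>j\<in>F. matpow I p (Suc k) i j) = (\<Sum>\<^sub>\<infinity>l\<in>I. \<Sum>j\<in>F. p i l * matpow I p k l j)"
    unfolding matpow.simps by (rule infsum_sum[symmetric]) (rule sm)
  also have "\<dots> \<le> infsum (p i) I"
    using Suc p_nonneg
    by (intro infsum_mono summable_on_sum sm summable_p) 
      (auto simp flip: sum_distrib_left intro!: mult_left_le)
  finally show ?case using infsum_p Suc by simp
qed

end

locale ergodic_chain = stochastic_matrix +
  assumes irreducible: "chain_irreducible I p"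
    and aperiodic: "chain_aperiodic I p"
    and positive_recurrent: "chain_positive_recurrent I p"
begin

definition lim_prob :: "nat \<Rightarrow> real" where
  "lim_prob j = lim (\<lambda>k. matpow I p k j j)"

text \<open>The return probabilities to \<open>j\<close> form a renewal sequence whose waiting time
  is the return time; recurrence makes its distribution sum to 1 and positive recurrence makes its
  mean finite.\<close>

lemma matpow_diag_tendsto:
  assumes "j \<in> I"
  shows "(\<lambda>k. matpow I p k j j) \<longlonglongrightarrow> lim_prob j" and "lim_prob j > 0"
proof -
  interpret renewal "\<lambda>n. first_passage I p n j j" "\<lambda>n. matpow I p n j j"
  proof
    show "0 \<le> first_passage I p n j j" for n
      using first_passage_bounds assms by blast
    show "matpow I p (Suc n) j j
        = (\<Sum>k\<le>n. first_passage I p (Suc k) j j * matpow I p (n - k) j j)" for n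
      using assms by (intro matpow_first_passage)
  qed (use assms aperiodic positive_recurrent
        in \<open>auto simp: chain_aperiodic_def chain_positive_recurrent_def\<close>)
  show "(\<lambda>k. matpow I p k j j) \<longlonglongrightarrow> lim_prob j"
    using renewal_limit unfolding lim_prob_def by (simp add: limI)
  with renewal_limit show "lim_prob j > 0"
    using renewal_limit_pos LIMSEQ_unique by metis
qed

text \<open>The limits exist by the first-passage decomposition. As functions of the initial state they
  are harmonic and maximal at \<open>j\<close>, hence constant by irreducibility.\<close>

lemma matpow_tendsto:
  assumes "i \<in> I" "j \<in> I"
  shows "(\<lambda>k. matpow I p k i j) \<longlonglongrightarrow> lim_prob j"
proof -
  \<comment> \<open>The probability of ever reaching \<open>j\<close> from \<open>i\<close>, times
    the limit of the return probabilities to \<open>j\<close>.\<close>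
  define g where "g = (\<lambda>i. (\<Sum>k. first_passage I p (Suc k) i j * lim_prob j))"
  have smf: "summable (\<lambda>k. first_passage I p (Suc k) i j)" 
    and smf1: "suminf (\<lambda>k. first_passage I p (Suc k) i j) \<le> 1" if "i \<in> I" for i
  proof -
    show sm: "summable (\<lambda>k. first_passage I p (Suc k) i j)"
      by (rule bounded_imp_summable[of _ 1]) (use first_passage_bounds[OF that assms(2)] in auto)
    show "suminf (\<lambda>k. first_passage I p (Suc k) i j) \<le> 1"
      using first_passage_bounds[OF that assms(2)] 
      by (intro suminf_le_const[OF sm]) (metis atLeast0LessThan lessThan_Suc_atMost lessThan_0 sum.empty zero_le_one not0_implies_Suc)
  qed
  have lim: "(\<lambda>k. matpow I p k i j) \<longlonglongrightarrow> g i" if i: "i \<in> I" for i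
  proof -
    \<comment> \<open>The first-passage decomposition written as a series with cutoff
      \<open>k \<le> n\<close>, so that dominated convergence applies with the first-passage
      probabilities as majorant.\<close>
    have "(\<lambda>n. \<Sum>k. if k \<le> n then first_passage I p (Suc k) i j * matpow I p (n - k) j j else 0)
        \<longlonglongrightarrow> g i"
      unfolding g_def
    proof (rule suminf_dominated_convergence[OF _ _ smf[OF i]])
      fix k
      have "(\<lambda>n. matpow I p (n - k) j j) \<longlonglongrightarrow> lim_prob j"
        using LIMSEQ_offset[of "\<lambda>n. matpow I p (n - k) j j" k] matpow_diag_tendsto[OF assms(2)] by simp
      then have "(\<lambda>n. first_passage I p (Suc k) i j * matpow I p (n - k) j j)
          \<longlonglongrightarrow> first_passage I p (Suc k) i j * lim_prob j"
        by (rule tendsto_mult_left)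
      moreover have "\<forall>\<^sub>F n in sequentially. first_passage I p (Suc k) i j * matpow I p (n - k) j j
          = (if k \<le> n then first_passage I p (Suc k) i j * matpow I p (n - k) j j else 0)"
        using eventually_ge_at_top[of k] by eventually_elim simp
      ultimately show "(\<lambda>n. if k \<le> n then first_passage I p (Suc k) i j * matpow I p (n - k) j j else 0)
          \<longlonglongrightarrow> first_passage I p (Suc k) i j * lim_prob j"
        by (rule Lim_transform_eventually)
    next
      show "\<bar>if k \<le> n then first_passage I p (Suc k) i j * matpow I p (n - k) j j else 0\<bar>
          \<le> first_passage I p (Suc k) i j" for k n
        using first_passage_bounds[OF i assms(2)] matpow_bounds[OF assms(2) assms(2)]
        by (auto simp: abs_mult intro!: mult_left_le)
    qed
    moreover have "(\<Sum>k. if k \<le> n then first_passage I p (Suc k) i j * matpow I p (n - k) j j else 0)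
        = matpow I p (Suc n) i j" for n
      unfolding matpow_first_passage[OF i assms(2)]
      by (subst suminf_finite[of "{..n}"]) auto
    ultimately have "(\<lambda>n. matpow I p (Suc n) i j) \<longlonglongrightarrow> g i" by simp
    then show ?thesis by (rule LIMSEQ_imp_Suc)
  qed
  have g_le: "0 \<le> g i \<and> g i \<le> lim_prob j" if "i \<in> I" for i
  proof
    show "0 \<le> g i"
      using LIMSEQ_le_const[OF lim[OF that], of 0] matpow_bounds[OF that assms(2)] by auto
    show "g i \<le> lim_prob j"
      unfolding g_def suminf_mult2[OF smf[OF that], symmetric]
      using smf1[OF that] matpow_diag_tendsto(2)[OF assms(2)] by (simp add: mult_le_cancel_right1)
  qed
  have harmonic: "g i = (\<Sum>\<^sub>\<infinity>l\<in>I. p i l * g l)" if i: "i \<in> I" for i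
  proof -
    have "(\<lambda>k. \<Sum>\<^sub>\<infinity>l\<in>I. p i l * matpow I p k l j) \<longlonglongrightarrow> (\<Sum>\<^sub>\<infinity>l\<in>I. p i l * g l)"
    proof (rule infsum_dominated_convergence[OF _ _ summable_p[OF i]])
      show "(\<lambda>k. p i l * matpow I p k l j) \<longlonglongrightarrow> p i l * g l" if "l \<in> I" for l
        using lim[OF that] by (rule tendsto_mult_left)
      show "\<bar>p i l * matpow I p k l j\<bar> \<le> p i l" if "l \<in> I" for l k
        using matpow_bounds[OF that assms(2)] p_nonneg[OF i that] by (auto simp: abs_mult intro!: mult_left_le)
    qed
    moreover have "(\<lambda>k. matpow I p (Suc k) i j) \<longlonglongrightarrow> g i"
      using lim[OF i] by (rule LIMSEQ_Suc)
    ultimately show ?thesis by (simp add: LIMSEQ_unique)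
  qed
  \<comment> \<open>Equality with the maximum is inherited along every transition of positive
    probability. It starts at \<open>j\<close>, and irreducibility provides a path from
    \<open>j\<close> to \<open>i\<close>.\<close>
  have "g l = lim_prob j" if "matpow I p k i l > 0" "i \<in> I" "l \<in> I" "g i = lim_prob j" for k i l
    using that
  proof (induction k arbitrary: i)
    case 0
    then show ?case by (simp split: if_splits)
  next
    case (Suc k)
    have "\<exists>r\<in>I. p i r * matpow I p k r l > 0"
    proof (rule ccontr)
      assume "\<not> ?thesis"
      then have "p i r * matpow I p k r l = 0" if "r \<in> I" for r
        using that p_nonneg[OF \<open>i \<in> I\<close> that] matpow_bounds[OF that \<open>l \<in> I\<close>]
        by (metis mult_nonneg_nonneg order_antisym_conv not_less)
      then have "matpow I p (Suc k) i l = 0"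
        unfolding matpow.simps by (intro infsum_0) auto
      with Suc.prems show False by simp
    qed
    then obtain r where r: "r \<in> I" "p i r > 0" "matpow I p k r l > 0"
      using p_nonneg[OF \<open>i \<in> I\<close>] by (fastforce simp: zero_less_mult_iff)
    have "g r = lim_prob j"
      by (rule infsum_p_diff_eq_0[OF \<open>i \<in> I\<close> r(1,2)]) (use g_le harmonic Suc.prems in auto)
    with r Suc show ?case by blast
  qed
  moreover have "g j = lim_prob j"
    using lim[OF assms(2)] matpow_diag_tendsto(1)[OF assms(2)] LIMSEQ_unique by blast
  moreover obtain k where "matpow I p k j i > 0"
    using irreducible assms unfolding chain_irreducible_def by blast
  ultimately have "g i = lim_prob j" using assms by blast
  with lim[OF assms(1)] show ?thesis by simp
qed

section \<open>The stationary distribution\<close>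

lemma lim_prob_nonneg: "j \<in> I \<Longrightarrow> 0 \<le> lim_prob j"
  using matpow_diag_tendsto(2) less_imp_le by blast

text \<open>The bound on finite partial row sums survives the limit. That no mass escapes is a
  separate matter, settled in \<open>infsum_lim_prob\<close>.\<close>

lemma sum_lim_prob_le_1:
  assumes "finite F" "F \<subseteq> I"
  shows "sum lim_prob F \<le> 1"
proof (cases "I = {}")
  case False
  then obtain i where "i \<in> I" by blast
  have "(\<lambda>k. \<Sum>j\<in>F. matpow I p k i j) \<longlonglongrightarrow> sum lim_prob F"
    using assms \<open>i \<in> I\<close> by (intro tendsto_sum matpow_tendsto) auto
  then show ?thesis
    by (rule LIMSEQ_le_const2) (use sum_matpow_le_1 assms \<open>i \<in> I\<close> in auto)
qed (use assms in simp)

lemma summable_lim_prob: "lim_prob summable_on I"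
  by (rule nonneg_bdd_above_summable_on)
    (use lim_prob_nonneg sum_lim_prob_le_1 in \<open>auto intro!: bdd_aboveI2[of _ _ 1]\<close>)

lemma summable_lim_prob_mult:
  assumes "\<And>j. j \<in> I \<Longrightarrow> \<bar>g j\<bar> \<le> 1"
  shows "(\<lambda>j. lim_prob j * g j) summable_on I"
proof (rule abs_summable_summable, rule summable_on_comparison_test[OF summable_lim_prob])
  show "norm (lim_prob j * g j) \<le> lim_prob j" if "j \<in> I" for j
    using that assms lim_prob_nonneg by (auto simp: abs_mult intro!: mult_left_le)
qed auto

lemma p_le_1: "i \<in> I \<Longrightarrow> j \<in> I \<Longrightarrow> p i j \<le> 1"
  using matpow_bounds[of i j "Suc 0"] matpow_Suc_0 by metis

text \<open>A Fatou argument: \<open>matpow_add_ge\<close> with last step of length one is taken to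
  the limit for each finite set of intermediate states.\<close>

lemma lim_prob_subinvariant:
  assumes "j \<in> I"
  shows "(\<Sum>\<^sub>\<infinity>l\<in>I. lim_prob l * p l j) \<le> lim_prob j"
proof (rule infsum_le_finite_sums)
  show "(\<lambda>l. lim_prob l * p l j) summable_on I"
    using assms p_nonneg p_le_1 by (intro summable_lim_prob_mult) auto
  fix F assume F: "finite F" "F \<subseteq> I"
  have "(\<lambda>k. \<Sum>l\<in>F. matpow I p k j l * p l j) \<longlonglongrightarrow> (\<Sum>l\<in>F. lim_prob l * p l j)"
    using F assms by (intro tendsto_sum tendsto_mult_right matpow_tendsto) auto
  moreover have "(\<lambda>k. matpow I p (Suc k) j j) \<longlonglongrightarrow> lim_prob j"
    using matpow_diag_tendsto(1)[OF assms] by (rule LIMSEQ_Suc)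
  moreover have "(\<Sum>l\<in>F. matpow I p k j l * p l j) \<le> matpow I p (Suc k) j j" for k
  proof -
    have "(\<Sum>l\<in>F. matpow I p k j l * p l j) = (\<Sum>l\<in>F. matpow I p k j l * matpow I p (Suc 0) l j)"
      using F assms matpow_Suc_0 by (intro sum.cong) (auto simp del: matpow.simps)
    then show ?thesis using matpow_add_ge[OF assms assms F, of k "Suc 0"] by simp
  qed
  ultimately show "(\<Sum>l\<in>F. lim_prob l * p l j) \<le> lim_prob j"
    using LIMSEQ_le by blast
qed

text \<open>Since rows sum to 1, summing both sides of \<open>lim_prob_subinvariant\<close> over
  \<open>j\<close> gives the same finite total. A termwise inequality between families of equal
  total is an equality.\<close>

lemma lim_prob_invariant:
  assumes "j \<in> I"
  shows "(\<Sum>\<^sub>\<infinity>l\<in>I. lim_prob l * p l j) = lim_prob j"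
proof -
  have hs: "((\<lambda>j. lim_prob l * p l j) has_sum lim_prob l) I" if "l \<in> I" for l
    using has_sum_cmult_right[OF p_has_sum[OF that], of "lim_prob l"] by simp
  have prod: "(\<lambda>(l, j). lim_prob l * p l j) summable_on I \<times> I"
    by (rule summable_on_SigmaI[OF _ summable_lim_prob]) (use hs p_nonneg lim_prob_nonneg in auto)
  have prod': "(\<lambda>(j, l). lim_prob l * p l j) summable_on I \<times> I"
    using prod by (subst summable_on_swap) simp
  have smj: "(\<lambda>j. \<Sum>\<^sub>\<infinity>l\<in>I. lim_prob l * p l j) summable_on I"
    using summable_on_Sigma_banach[OF prod'] by simp
  have "(\<Sum>\<^sub>\<infinity>j\<in>I. \<Sum>\<^sub>\<infinity>l\<in>I. lim_prob l * p l j) = (\<Sum>\<^sub>\<infinity>l\<in>I. \<Sum>\<^sub>\<infinity>j\<in>I. lim_prob l * p l j)"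
    by (rule infsum_swap_banach[OF prod'])
  also have "\<dots> = infsum lim_prob I"
    by (rule infsum_cong) (use hs infsumI in blast)
  finally have "(\<Sum>\<^sub>\<infinity>j\<in>I. lim_prob j - (\<Sum>\<^sub>\<infinity>l\<in>I. lim_prob l * p l j)) = 0"
    using infsum_diff[OF summable_lim_prob smj] by simp
  then have "lim_prob j - (\<Sum>\<^sub>\<infinity>l\<in>I. lim_prob l * p l j) = 0"
    using assms lim_prob_subinvariant summable_on_diff[OF summable_lim_prob smj]
    by (intro nonneg_infsum_le_0D[of "\<lambda>j. lim_prob j - (\<Sum>\<^sub>\<infinity>l\<in>I. lim_prob l * p l j)" I]) auto
  then show ?thesis by simp
qed

text \<open>By exchanging the two sums, the first transition of \<open>matpow\<close> is averaged
  against the weights, and \<open>lim_prob_invariant\<close> absorbs it.\<close>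

lemma lim_prob_invariant_matpow:
  assumes "j \<in> I"
  shows "(\<Sum>\<^sub>\<infinity>l\<in>I. lim_prob l * matpow I p n l j) = lim_prob j"
proof (induction n)
  case 0
  have "(\<Sum>\<^sub>\<infinity>l\<in>I. lim_prob l * matpow I p 0 l j) = (\<Sum>\<^sub>\<infinity>l\<in>{j}. lim_prob l)"
    by (rule infsum_cong_neutral) (use assms in auto)
  then show ?case by simp
next
  case (Suc n)
  have hs: "((\<lambda>r. lim_prob l * (p l r * matpow I p n r j)) has_sum lim_prob l * matpow I p (Suc n) l j) I"
    if "l \<in> I" for l
    unfolding matpow.simps
    using summable_p_matpow[OF that assms order_refl, of n]
    by (intro has_sum_cmult_right has_sum_infsum)
  have "(\<lambda>l. lim_prob l * matpow I p (Suc n) l j) summable_on I"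
    using matpow_bounds assms by (intro summable_lim_prob_mult) (auto simp del: matpow.simps)
  then have prod: "(\<lambda>(l, r). lim_prob l * (p l r * matpow I p n r j)) summable_on I \<times> I"
    by (rule summable_on_SigmaI[rotated]) (use hs p_nonneg lim_prob_nonneg matpow_bounds assms in auto)
  have "(\<Sum>\<^sub>\<infinity>l\<in>I. lim_prob l * matpow I p (Suc n) l j)
      = (\<Sum>\<^sub>\<infinity>l\<in>I. \<Sum>\<^sub>\<infinity>r\<in>I. lim_prob l * (p l r * matpow I p n r j))"
    by (rule infsum_cong) (rule infsumI[OF hs, symmetric])
  also have "\<dots> = (\<Sum>\<^sub>\<infinity>r\<in>I. \<Sum>\<^sub>\<infinity>l\<in>I. lim_prob l * (p l r * matpow I p n r j))"
    by (rule infsum_swap_banach[OF prod])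
  also have "\<dots> = (\<Sum>\<^sub>\<infinity>r\<in>I. lim_prob r * matpow I p n r j)"
    by (rule infsum_cong) (simp add: infsum_cmult_left' lim_prob_invariant flip: mult.assoc)
  finally show ?case using Suc by simp
qed

text \<open>Letting \<open>n\<close> tend to infinity in the invariance under \<open>n\<close> steps
  gives \<open>lim_prob j = infsum lim_prob I * lim_prob j\<close>, and \<open>lim_prob j\<close> is
  positive.\<close>

lemma infsum_lim_prob:
  assumes "I \<noteq> {}"
  shows "infsum lim_prob I = 1"
proof -
  obtain j where j: "j \<in> I" using assms by blast
  have "(\<lambda>n. \<Sum>\<^sub>\<infinity>l\<in>I. lim_prob l * matpow I p n l j) \<longlonglongrightarrow> (\<Sum>\<^sub>\<infinity>l\<in>I. lim_prob l * lim_prob j)"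
  proof (rule infsum_dominated_convergence[OF _ _ summable_lim_prob])
    show "(\<lambda>n. lim_prob l * matpow I p n l j) \<longlonglongrightarrow> lim_prob l * lim_prob j" if "l \<in> I" for l
      using matpow_tendsto[OF that j] by (rule tendsto_mult_left)
    show "\<bar>lim_prob l * matpow I p n l j\<bar> \<le> lim_prob l" if "l \<in> I" for l n
      using matpow_bounds[OF that j] lim_prob_nonneg[OF that] by (auto simp: abs_mult intro!: mult_left_le)
  qed
  then have "lim_prob j = infsum lim_prob I * lim_prob j"
    using lim_prob_invariant_matpow[OF j] by (simp add: infsum_cmult_left' LIMSEQ_const_iff)
  with matpow_diag_tendsto(2)[OF j] show ?thesis by simp
qed

text \<open>Only lower bounds for the limit inferior are needed, since they also apply to \<open>1 - a k\<close>.\<close>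

lemma backward_iterates_tendsto:
  fixes a :: "nat \<Rightarrow> nat \<Rightarrow> real"
  assumes i: "i \<in> I"
    and bounds: "\<And>k j. j \<in> I \<Longrightarrow> 0 \<le> a k j \<and> a k j \<le> 1"
    and step: "\<And>k j. j \<in> I \<Longrightarrow> a (Suc k) j = (\<Sum>\<^sub>\<infinity>l\<in>I. p j l * a k l)"
  shows "(\<lambda>k. a k i) \<longlonglongrightarrow> (\<Sum>\<^sub>\<infinity>j\<in>I. lim_prob j * a 0 j)"
proof -
  have lower: "\<forall>\<^sub>F k in sequentially. (\<Sum>\<^sub>\<infinity>j\<in>I. lim_prob j * a 0 j) - e < a k i"
    if bounds: "\<And>k j. j \<in> I \<Longrightarrow> 0 \<le> a k j \<and> a k j \<le> 1"
      and step: "\<And>k j. j \<in> I \<Longrightarrow> a (Suc k) j = (\<Sum>\<^sub>\<infinity>l\<in>I. p j l * a k l)"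
      and "e > 0" for a e
  proof -
    \<comment> \<open>Unrolling the recursion expresses \<open>a k i\<close> as the average of
      \<open>a 0\<close> over the states reached in \<open>k\<close> steps; by non-negativity, every
      finite part of this average is a lower bound.\<close>
    have ge: "(\<Sum>j\<in>F. matpow I p k i j * a 0 j) \<le> a k i" if "finite F" "F \<subseteq> I" "i \<in> I" for F k i
      using that(3)
    proof (induction k arbitrary: i)
      case 0
      have "(\<Sum>j\<in>F. matpow I p 0 i j * a 0 j) = (if i \<in> F then a 0 i else 0)"
        using that(1) by (simp add: if_distrib[of "\<lambda>x. x * _"] cong: if_cong)
      with 0 bounds show ?case by auto
    next
      case (Suc k)
      have sm: "(\<lambda>l. p i l * (matpow I p k l j * a 0 j)) summable_on I" if "j \<in> F" for j
        using Suc.prems that \<open>F \<subseteq> I\<close> matpow_bounds bounds[of j 0]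
        by (intro summable_p_mult[of _ _ _ 1]) (auto simp: abs_mult subset_iff intro!: mult_le_one)
      have "(\<Sum>j\<in>F. matpow I p (Suc k) i j * a 0 j)
          = (\<Sum>j\<in>F. \<Sum>\<^sub>\<infinity>l\<in>I. p i l * (matpow I p k l j * a 0 j))"
        by (simp add: infsum_cmult_left' flip: mult.assoc)
      also have "\<dots> = (\<Sum>\<^sub>\<infinity>l\<in>I. \<Sum>j\<in>F. p i l * (matpow I p k l j * a 0 j))"
        by (rule infsum_sum[symmetric]) (rule sm)
      also have "\<dots> \<le> (\<Sum>\<^sub>\<infinity>l\<in>I. p i l * a k l)"
        using Suc p_nonneg bounds
        by (intro infsum_mono summable_on_sum sm summable_p_mult[of _ _ _ 1])
          (auto simp flip: sum_distrib_left intro!: mult_left_mono)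
      finally show ?case using step Suc.prems by simp
    qed
    have "((\<lambda>j. lim_prob j * a 0 j) has_sum (\<Sum>\<^sub>\<infinity>j\<in>I. lim_prob j * a 0 j)) I"
      using bounds by (intro has_sum_infsum summable_lim_prob_mult) auto
    \<comment> \<open>A finite set of states already carries the sum up to \<open>e\<close>, and on
      a finite set the limit in \<open>k\<close> can be taken term by term.\<close>
    then have "\<forall>\<^sub>F F in finite_subsets_at_top I.
        (\<Sum>\<^sub>\<infinity>j\<in>I. lim_prob j * a 0 j) - e < (\<Sum>j\<in>F. lim_prob j * a 0 j)"
      unfolding has_sum_def using \<open>e > 0\<close> by (auto dest!: order_tendstoD(1))
    then obtain F where F: "finite F" "F \<subseteq> I"
        "(\<Sum>\<^sub>\<infinity>j\<in>I. lim_prob j * a 0 j) - e < (\<Sum>j\<in>F. lim_prob j * a 0 j)"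
      by (auto simp: eventually_finite_subsets_at_top)
    have "(\<lambda>k. \<Sum>j\<in>F. matpow I p k i j * a 0 j) \<longlonglongrightarrow> (\<Sum>j\<in>F. lim_prob j * a 0 j)"
      using F i by (intro tendsto_sum tendsto_mult_right matpow_tendsto) auto
    from order_tendstoD(1)[OF this F(3)] show ?thesis
      by eventually_elim (use ge[OF F(1,2) i] in \<open>auto intro: less_le_trans\<close>)
  qed
  have sm: "(\<lambda>j. lim_prob j * a 0 j) summable_on I"
    using bounds by (intro summable_lim_prob_mult) auto
  have compl: "(\<Sum>\<^sub>\<infinity>j\<in>I. lim_prob j * (1 - a 0 j)) = 1 - (\<Sum>\<^sub>\<infinity>j\<in>I. lim_prob j * a 0 j)"
    using infsum_diff[OF summable_lim_prob sm] infsum_lim_prob i by (auto simp: right_diff_distrib)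
  have step': "1 - a (Suc k) j = (\<Sum>\<^sub>\<infinity>l\<in>I. p j l * (1 - a k l))" if "j \<in> I" for k j
  proof -
    have "(\<lambda>l. p j l * a k l) summable_on I"
      using bounds that by (intro summable_p_mult[of _ _ _ 1]) auto
    from infsum_diff[OF summable_p[OF that] this] show ?thesis
      using step[OF that] infsum_p[OF that] by (simp add: right_diff_distrib)
  qed
  show ?thesis
  proof (rule tendstoI)
    fix e :: real assume e: "e > 0"
    have "\<forall>\<^sub>F k in sequentially. (\<Sum>\<^sub>\<infinity>j\<in>I. lim_prob j * a 0 j) - e < a k i"
      by (rule lower) (use bounds step e in auto)
    moreover have "\<forall>\<^sub>F k in sequentially. (\<Sum>\<^sub>\<infinity>j\<in>I. lim_prob j * (1 - a 0 j)) - e < 1 - a k i"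
      by (rule lower[of "\<lambda>k j. 1 - a k j"]) (use bounds step' e in auto)
    ultimately show "\<forall>\<^sub>F k in sequentially. dist (a k i) (\<Sum>\<^sub>\<infinity>j\<in>I. lim_prob j * a 0 j) < e"
      unfolding compl by eventually_elim (simp add: dist_real_def abs_less_iff)
  qed
qed

end

section \<open>Asymptotic independence\<close>

text \<open>In the applications \<open>T k\<close> is the \<open>k\<close>-th preimage of a fixed
  set and \<open>c\<close> is the limit of its measures, so the condition states that
  \<open>B\<close> and \<open>T k\<close> become independent.\<close>

definition asymp_indep :: "'a measure \<Rightarrow> (nat \<Rightarrow> 'a set) \<Rightarrow> real \<Rightarrow> 'a set \<Rightarrow> bool" where
  "asymp_indep M T c B \<longleftrightarrow> (\<lambda>k. measure M (B \<inter> T k)) \<longlonglongrightarrow> c * measure M B"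

context finite_measure
begin

section \<open>Closure under Dynkin operations and approximation\<close>

lemma asymp_indep_empty: "asymp_indep M T c {}"
  by (simp add: asymp_indep_def)

lemma asymp_indep_Diff:
  assumes "asymp_indep M T c A" "asymp_indep M T c B" "B \<subseteq> A"
    and "A \<in> sets M" "B \<in> sets M" "\<And>k. T k \<in> sets M"
  shows "asymp_indep M T c (A - B)"
proof -
  have "measure M ((A - B) \<inter> T k) = measure M (A \<inter> T k) - measure M (B \<inter> T k)" for k
  proof -
    have "(A - B) \<inter> T k = A \<inter> T k - B \<inter> T k" by blast
    moreover have "B \<inter> T k \<subseteq> A \<inter> T k" using assms(3) by blast
    ultimately show ?thesis using assms by (simp add: finite_measure_Diff)
  qed
  moreover have "measure M (A - B) = measure M A - measure M B"
    using assms by (simp add: finite_measure_Diff)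
  ultimately show ?thesis
    using assms(1,2) unfolding asymp_indep_def by (simp add: right_diff_distrib tendsto_diff)
qed

text \<open>The measures of the \<open>B n\<close> dominate the summands uniformly in
  \<open>k\<close>, so limit and sum can be exchanged.\<close>

lemma asymp_indep_UN:
  fixes B :: "nat \<Rightarrow> 'a set"
  assumes "\<And>n. asymp_indep M T c (B n)" "disjoint_family B" "range B \<subseteq> sets M" "\<And>k. T k \<in> sets M"
  shows "asymp_indep M T c (\<Union>n. B n)"
proof -
  have sums: "(\<lambda>n. measure M (B n)) sums measure M (\<Union>n. B n)"
    using assms by (intro finite_measure_UNION) auto
  have "(\<lambda>n. measure M (B n \<inter> T k)) sums measure M (\<Union>n. B n \<inter> T k)" for k
    using assms by (intro finite_measure_UNION) (auto simp: disjoint_family_on_def)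
  then have *: "measure M ((\<Union>n. B n) \<inter> T k) = (\<Sum>n. measure M (B n \<inter> T k))" for k
    by (simp add: sums_iff)
  have "(\<lambda>k. \<Sum>n. measure M (B n \<inter> T k)) \<longlonglongrightarrow> (\<Sum>n. c * measure M (B n))"
  proof (rule suminf_dominated_convergence[where M = "\<lambda>n. measure M (B n)"])
    show "(\<lambda>k. measure M (B n \<inter> T k)) \<longlonglongrightarrow> c * measure M (B n)" for n
      using assms(1) by (simp add: asymp_indep_def)
    show "\<bar>measure M (B n \<inter> T k)\<bar> \<le> measure M (B n)" for n k
      using assms by (auto intro!: finite_measure_mono)
  qed (use sums in \<open>simp add: sums_iff\<close>)
  also have "(\<Sum>n. c * measure M (B n)) = c * measure M (\<Union>n. B n)"
    using sums by (simp add: suminf_mult sums_iff)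
  finally show ?thesis by (simp only: asymp_indep_def *)
qed

lemma abs_measure_diff_le:
  assumes "A \<in> sets M" "B \<in> sets M"
  shows "\<bar>measure M A - measure M B\<bar> \<le> measure M (sym_diff A B)"
proof -
  have "measure M A \<le> measure M (B \<union> sym_diff A B)" "measure M B \<le> measure M (A \<union> sym_diff A B)"
    using assms by (auto intro!: finite_measure_mono)
  moreover have "measure M (B \<union> sym_diff A B) \<le> measure M B + measure M (sym_diff A B)"
    "measure M (A \<union> sym_diff A B) \<le> measure M A + measure M (sym_diff A B)"
    using assms by (auto intro!: measure_Un_le)
  ultimately show ?thesis by linarith
qed

text \<open>Replacing \<open>B\<close> by \<open>B'\<close> changes the measure of the intersection
  with \<open>T k\<close> by at most that of the symmetric difference, uniformly in
  \<open>k\<close>. As \<open>0 \<le> c \<le> 1\<close>, the same bound holds for the limit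
  value.\<close>

lemma asymp_indep_approx:
  assumes approx: "\<And>e. e > 0 \<Longrightarrow> \<exists>B'\<in>sets M. asymp_indep M T c B' \<and> measure M (sym_diff B B') < e"
    and B: "B \<in> sets M" and T: "\<And>k. T k \<in> sets M" and c: "0 \<le> c" "c \<le> 1"
  shows "asymp_indep M T c B"
  unfolding asymp_indep_def
proof (rule tendstoI)
  fix e :: real assume "e > 0"
  then obtain B' where B': "B' \<in> sets M" "asymp_indep M T c B'" "measure M (sym_diff B B') < e / 3"
    using approx[of "e / 3"] by auto
  have "\<forall>\<^sub>F k in sequentially. dist (measure M (B' \<inter> T k)) (c * measure M B') < e / 3"
    using B'(2) \<open>e > 0\<close> unfolding asymp_indep_def by (intro tendstoD) auto
  then show "\<forall>\<^sub>F k in sequentially. dist (measure M (B \<inter> T k)) (c * measure M B) < e"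
  proof eventually_elim
    case (elim k)
    have "\<bar>measure M (B \<inter> T k) - measure M (B' \<inter> T k)\<bar> \<le> measure M (sym_diff (B \<inter> T k) (B' \<inter> T k))"
      using B B' T by (intro abs_measure_diff_le) auto
    also have "\<dots> \<le> measure M (sym_diff B B')"
      using B B' T by (intro finite_measure_mono) auto
    finally have 1: "\<bar>measure M (B \<inter> T k) - measure M (B' \<inter> T k)\<bar> < e / 3"
      using B' by simp
    have "\<bar>c * measure M B - c * measure M B'\<bar> = c * \<bar>measure M B - measure M B'\<bar>"
      using c by (simp add: abs_mult flip: right_diff_distrib)
    also have "\<dots> \<le> \<bar>measure M B - measure M B'\<bar>"
      using c by (intro mult_left_le_one_le) auto
    also have "\<dots> < e / 3"
      using abs_measure_diff_le[OF B B'(1)] B'(3) by simp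
    finally show ?case using 1 elim unfolding dist_real_def by linarith
  qed
qed

end

section \<open>Linear Markov partitions\<close>

lemma emeasure_eq_null_diff:
  assumes "N \<in> null_sets M" "A \<in> sets M" "B \<in> sets M" "A \<subseteq> B \<union> N" "B \<subseteq> A \<union> N"
  shows "emeasure M A = emeasure M B"
proof (rule emeasure_eq_AE)
  show "AE x in M. x \<in> A \<longleftrightarrow> x \<in> B"
    using AE_not_in[OF assms(1)] by eventually_elim (use assms in blast)
qed (use assms in auto)

lemma measure_eq_null_diff:
  assumes "N \<in> null_sets M" "A \<in> sets M" "B \<in> sets M" "A \<subseteq> B \<union> N" "B \<subseteq> A \<union> N"
  shows "measure M A = measure M B"
  using emeasure_eq_null_diff[OF assms] by (simp add: measure_def)

text \<open>A non-empty open set contains two points \<open>x\<close> and \<open>x + e / 2\<close>,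
  and two points determine the slope; this makes the definite description in \<open>slope\<close>
  meaningful.\<close>

lemma slope_eqI:
  assumes "interior A \<noteq> {}" "\<And>x. x \<in> interior A \<Longrightarrow> f x = a * x + b"
  shows "slope f A = a"
  unfolding slope_def
proof (rule the_equality)
  show "\<exists>b. \<forall>x\<in>interior A. f x = a * x + b" using assms by blast
  fix a' assume "\<exists>b'. \<forall>x\<in>interior A. f x = a' * x + b'"
  then obtain b' where b': "\<And>x. x \<in> interior A \<Longrightarrow> f x = a' * x + b'" by blast
  obtain x where x: "x \<in> interior A" using assms by blast
  obtain e where e: "e > 0" "ball x e \<subseteq> interior A"
    using open_interior x openE by blast
  have "x + e / 2 \<in> interior A" using e by (auto simp: dist_real_def intro!: subsetD[OF e(2)])
  with assms(2) b' x have "a * x + b = a' * x + b'" "a * (x + e / 2) + b = a' * (x + e / 2) + b'"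
    by metis+
  then have "a * (e / 2) = a' * (e / 2)" unfolding distrib_left by linarith
  with e show "a' = a" by simp
qed

text \<open>Any two points of \<open>A\<close> span a segment inside \<open>A\<close>, so their
  distance is at most the measure of \<open>A\<close>. Hence \<open>A\<close> is bounded, and a
  compact interval.\<close>

lemma closed_nd_interval_real:
  assumes "closed_nd_interval A" "emeasure lebesgue A < \<infinity>"
  obtains a b where "a < b" "A = {a..b}"
proof -
  have A: "closed A" "is_interval A" "interior A \<noteq> {}"
    using assms by (auto simp: closed_nd_interval_def)
  have sub: "{x..y} \<subseteq> A" if "x \<in> A" "y \<in> A" for x y
    by (auto intro: mem_is_interval_1_I[OF A(2) that])
  obtain x where x: "x \<in> A" using A interior_subset by blast
  have len: "y - x \<le> measure lebesgue A" if "x \<in> A" "y \<in> A" "x \<le> y" for x y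
  proof -
    have "A \<in> lmeasurable" using A assms by (auto simp: fmeasurable_def)
    then have "measure lebesgue {x..y} \<le> measure lebesgue A"
      using sub[OF that(1,2)] by (intro measure_mono_fmeasurable) auto
    then show ?thesis using that by simp
  qed
  have "\<bar>y\<bar> \<le> \<bar>x\<bar> + measure lebesgue A" if "y \<in> A" for y
    using len[of x y] len[of y x] x that by linarith
  then have "bounded A" by (auto simp: bounded_iff)
  then have "compact A" using A by (simp add: compact_eq_bounded_closed)
  moreover have "connected A" using A is_interval_connected_1 by blast
  ultimately obtain a b where ab: "A = {a..b}" using connected_compact_interval_1 by metis
  then have "a < b" using A(3) by simp
  from that[OF this ab] show thesis .
qed

locale markov_system =
  fixes X :: "real set" and f :: "real \<Rightarrow> real" and \<H> :: "real set set"
    and I :: "nat set" and H :: "nat \<Rightarrow> real set"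
  assumes system: "interval_system X f"
    and partition: "linear_markov_partition X f \<H>"
    and enum: "enumerates I H \<H>"
    and fin: "\<forall>i\<in>I. emeasure lebesgue (H i) < \<infinity>"
begin

abbreviation "p \<equiv> transition_matrix f H"

definition preim :: "nat \<Rightarrow> real set \<Rightarrow> real set" where
  "preim k E = {x \<in> X. (f ^^ k) x \<in> E}"

text \<open>The countable set of endpoints. Distinct partition elements meet only here, and only
  here may \<open>f\<close> deviate from its affine pieces.\<close>

definition boundary :: "real set" where
  "boundary = (\<Union>i\<in>I. H i - interior (H i))"

text \<open>The measure written q with index \<open>i\<close> in the overview, regarded as a measure
  on all Lebesgue subsets of the line.\<close>

definition M :: "nat \<Rightarrow> real measure" where
  "M i = uniform_measure lebesgue (H i)"

lemma X_eq: "X = (\<Union>i\<in>I. H i)"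
  using partition enum unfolding linear_markov_partition_def enumerates_def bij_betw_def by auto

lemma H_in: "i \<in> I \<Longrightarrow> H i \<in> \<H>"
  using enum unfolding enumerates_def bij_betw_def by auto

lemma H_obtain:
  assumes "i \<in> I"
  obtains a b where "a < b" "H i = {a..b}"
proof (rule closed_nd_interval_real[of "H i"])
  show "closed_nd_interval (H i)"
    using H_in[OF assms] partition by (simp add: linear_markov_partition_def)
  show "emeasure lebesgue (H i) < \<infinity>" using fin assms by blast
qed (rule that)

lemma interior_disjoint:
  assumes "i \<in> I" "j \<in> I" "i \<noteq> j"
  shows "interior (H i) \<inter> interior (H j) = {}"
proof -
  have "H i \<noteq> H j" using enum assms unfolding enumerates_def bij_betw_def inj_on_def by blast
  moreover have "\<forall>A\<in>\<H>. \<forall>B\<in>\<H>. A \<noteq> B \<longrightarrow> interior A \<inter> interior B = {}"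
    using partition by (simp add: linear_markov_partition_def)
  ultimately show ?thesis using H_in[OF assms(1)] H_in[OF assms(2)] by blast
qed

lemma interior_subset_X: "i \<in> I \<Longrightarrow> interior (H i) \<subseteq> X"
  using interior_subset X_eq by blast

lemma sets_H [measurable]: "i \<in> I \<Longrightarrow> H i \<in> sets lebesgue"
proof -
  assume "i \<in> I"
  then obtain a b where "a < b" "H i = {a..b}" by (rule H_obtain)
  then show ?thesis by simp
qed

lemma measure_H_pos: "i \<in> I \<Longrightarrow> 0 < measure lebesgue (H i)"
proof -
  assume "i \<in> I"
  then obtain a b where "a < b" "H i = {a..b}" by (rule H_obtain)
  then show ?thesis by simp
qed

lemma emeasure_H: "i \<in> I \<Longrightarrow> emeasure lebesgue (H i) = ennreal (measure lebesgue (H i))"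
  using fin by (intro emeasure_eq_ennreal_measure) auto

lemma emeasure_H_nontrivial: "i \<in> I \<Longrightarrow> emeasure lebesgue (H i) \<noteq> 0" "i \<in> I \<Longrightarrow> emeasure lebesgue (H i) \<noteq> \<infinity>"
proof -
  assume i: "i \<in> I"
  show "emeasure lebesgue (H i) \<noteq> 0"
    unfolding emeasure_H[OF i] using measure_H_pos[OF i] by simp
  show "emeasure lebesgue (H i) \<noteq> \<infinity>"
    unfolding emeasure_H[OF i] by simp
qed

lemma finite_H_boundary: "i \<in> I \<Longrightarrow> finite (H i - interior (H i))"
proof -
  assume "i \<in> I"
  then obtain a b where "a < b" "H i = {a..b}" by (rule H_obtain)
  then have "H i - interior (H i) \<subseteq> {a, b}" by (auto simp: interior_atLeastAtMost_real)
  then show ?thesis by (rule finite_subset) simp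
qed

lemma boundary_null: "boundary \<in> null_sets lebesgue"
  unfolding boundary_def
  using finite_H_boundary negligible_finite
  by (intro null_sets_UN') (auto simp: negligible_iff_null_sets)

lemma X_cover: "X \<subseteq> (\<Union>i\<in>I. interior (H i)) \<union> boundary"
  unfolding X_eq boundary_def by blast

lemma sets_X [measurable]: "X \<in> sets lebesgue"
  using system by (simp add: interval_system_def)

lemma f_in_X: "x \<in> X \<Longrightarrow> f x \<in> X"
  using system measurable_space[of f "lebesgue_on X" "lebesgue_on X" x]
  by (simp add: interval_system_def space_restrict_space)

section \<open>Iterated preimages and their measures\<close>

lemma preim_subset: "preim k E \<subseteq> X"
  by (auto simp: preim_def)

lemma preim_0: "E \<subseteq> X \<Longrightarrow> preim 0 E = E"
  by (auto simp: preim_def)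

text \<open>The first application of \<open>f\<close> is split off, in parallel with the first step
  of the chain in \<open>matpow\<close>.\<close>

lemma preim_Suc: "preim (Suc k) E = preim (Suc 0) (preim k E)"
  by (auto simp: preim_def f_in_X funpow_swap1)

lemma preim_Int: "preim k (E \<inter> F) = preim k E \<inter> preim k F"
  by (auto simp: preim_def)

lemma sets_preim_Suc_0:
  assumes "E \<in> sets lebesgue"
  shows "preim (Suc 0) E \<in> sets lebesgue"
proof -
  have "E \<inter> X \<in> sets (lebesgue_on X)"
    using assms by (auto simp: sets_restrict_space)
  then have "f -` (E \<inter> X) \<inter> space (lebesgue_on X) \<in> sets (lebesgue_on X)"
    by (rule measurable_sets[rotated]) (use system in \<open>simp add: interval_system_def\<close>)
  also have "f -` (E \<inter> X) \<inter> space (lebesgue_on X) = preim (Suc 0) E"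
    by (auto simp: preim_def f_in_X space_restrict_space)
  finally show ?thesis
    by (simp add: sets_restrict_space_iff)
qed

lemma sets_preim:
  assumes "E \<in> sets lebesgue"
  shows "preim k E \<in> sets lebesgue"
proof (induction k)
  case 0
  have "preim 0 E = E \<inter> X" by (auto simp: preim_def)
  with assms show ?case by simp
next
  case (Suc k)
  then show ?case unfolding preim_Suc[of k] by (rule sets_preim_Suc_0)
qed

lemma sets_M [simp]: "sets (M i) = sets lebesgue" and space_M [simp]: "space (M i) = UNIV"
  by (simp_all add: M_def)

lemma prob_space_M: "i \<in> I \<Longrightarrow> prob_space (M i)"
  unfolding M_def by (intro prob_space_uniform_measure emeasure_H_nontrivial)

lemma measure_M:
  assumes "i \<in> I" "E \<in> sets lebesgue"
  shows "measure (M i) E = measure lebesgue (H i \<inter> E) / measure lebesgue (H i)"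
  unfolding M_def using assms emeasure_H_nontrivial by simp

lemma measure_M_bounds: "i \<in> I \<Longrightarrow> 0 \<le> measure (M i) E \<and> measure (M i) E \<le> 1"
  using prob_space.prob_le_1[OF prob_space_M] by simp

lemma measure_M_X: "i \<in> I \<Longrightarrow> measure (M i) X = 1"
proof -
  assume i: "i \<in> I"
  then have "H i \<inter> X = H i" using X_eq by blast
  then show ?thesis using measure_M[OF i sets_X] measure_H_pos[OF i] by simp
qed

lemma null_sets_M: "i \<in> I \<Longrightarrow> N \<in> null_sets lebesgue \<Longrightarrow> N \<in> null_sets (M i)"
  unfolding M_def null_sets_def
  using null_set_Int2[of N lebesgue "H i"] sets_H by (auto simp: null_sets_def Int_commute)

text \<open>The interiors are disjoint, so countable additivity applies to them; passing from
  \<open>interior (H j)\<close> to \<open>H j\<close> costs only boundary points.\<close>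

lemma has_sum_measure_H:
  assumes J: "J \<subseteq> I" and E: "E \<in> sets lebesgue"
    and finite: "emeasure lebesgue (\<Union>j\<in>J. E \<inter> interior (H j)) < \<infinity>"
  shows "((\<lambda>j. measure lebesgue (H j \<inter> E)) has_sum measure lebesgue (\<Union>j\<in>J. E \<inter> interior (H j))) J"
proof -
  define F where "F = (\<lambda>j. if j \<in> J then E \<inter> interior (H j) else {})"
  have F: "range F \<subseteq> sets lebesgue" "disjoint_family F" "(\<Union>j. F j) = (\<Union>j\<in>J. E \<inter> interior (H j))"
    using E J interior_disjoint by (auto simp: F_def disjoint_family_on_def split: if_splits)
  then have "(\<lambda>j. measure lebesgue (F j)) sums measure lebesgue (\<Union>j. F j)"
    using finite by (intro measure_UNION) auto
  then have "((\<lambda>j. measure lebesgue (F j)) has_sum measure lebesgue (\<Union>j. F j)) UNIV"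
    by (rule sums_nonneg_imp_has_sum) simp
  also have "?this \<longleftrightarrow> ((\<lambda>j. measure lebesgue (H j \<inter> E)) has_sum measure lebesgue (\<Union>j. F j)) J"
  proof (rule has_sum_cong_neutral)
    fix j assume "j \<in> UNIV \<inter> J"
    then show "measure lebesgue (F j) = measure lebesgue (H j \<inter> E)"
      using E J interior_subset[of "H j"]
      by (intro measure_eq_null_diff[OF boundary_null]) (auto simp: F_def boundary_def)
  qed (auto simp: F_def)
  finally show ?thesis unfolding F(3) .
qed

text \<open>The link between dynamics and chain. On its interior, \<open>H i\<close> is stretched by
  the absolute value of the slope onto a set that is, up to null sets, the union of those
  \<open>H j\<close> whose interior lies in the image of \<open>H i\<close>. The part of
  \<open>E\<close> in each such \<open>H j\<close> thus contributes
  \<open>p i j * measure (M j) E\<close>.\<close>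

lemma transfer:
  assumes i: "i \<in> I" and E: "E \<in> sets lebesgue" "E \<subseteq> X"
  shows "((\<lambda>j. p i j * measure (M j) E) has_sum measure (M i) (preim (Suc 0) E)) I"
proof -
  obtain a b where ab: "a < b" "H i = {a..b}" by (rule H_obtain[OF i])
  have int: "interior (H i) \<noteq> {}" using ab by (simp add: interior_atLeastAtMost_real)
  obtain s t where st: "\<And>x. x \<in> interior (H i) \<Longrightarrow> f x = s * x + t"
  proof -
    have "affine_on_set (interior (H i)) f"
      using partition H_in[OF i] by (simp add: linear_markov_partition_def)
    then show thesis using that unfolding affine_on_set_def by blast
  qed
  have slope: "slope f (H i) = s" by (rule slope_eqI[OF int st])
  define U where "U = f ` interior (H i)"
  define V where "V = interior (f ` H i)"
  have U_eq: "U = (\<lambda>x. s * x + t) ` interior (H i)" unfolding U_def by (rule image_cong) (auto simp: st)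
  obtain \<A> where \<A>: "\<A> \<noteq> {}" "\<A> \<subseteq> \<H>" "V = interior (\<Union>\<A>)"
  proof -
    have "\<exists>\<A>. \<A> \<noteq> {} \<and> \<A> \<subseteq> \<H> \<and> interior (f ` H i) = interior (\<Union>\<A>)"
      using partition H_in[OF i] by (simp add: linear_markov_partition_def)
    then show thesis using that unfolding V_def by blast
  qed
  have image_sub: "f ` H i \<subseteq> U \<union> f ` (H i - interior (H i))"
    unfolding U_def by blast
  \<comment> \<open>With slope 0 the image of \<open>H i\<close> would be finite, but by the Markov
    property its interior contains that of some partition element.\<close>
  have s: "s \<noteq> 0"
  proof
    assume "s = 0"
    then have "U \<subseteq> {t}" unfolding U_eq by auto
    then have "finite (f ` H i)"
      using finite_H_boundary[OF i] finite_subset[OF image_sub] finite_subset[of U "{t}"] by auto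
    then have "V = {}" unfolding V_def by (simp add: empty_interior_finite)
    moreover obtain A where A: "A \<in> \<A>" using \<A> by blast
    then have "interior A \<subseteq> V" unfolding \<A>(3) by (intro interior_mono) blast
    moreover have "interior A \<noteq> {}"
      using A \<A>(2) partition by (auto simp: linear_markov_partition_def closed_nd_interval_def)
    ultimately show False by blast
  qed
  have "open U"
    unfolding U_eq using open_affinity[of "interior (H i)" s t] s by (simp add: add.commute)
  then have UV: "U \<subseteq> V"
    unfolding V_def U_def using interior_subset by (intro interior_maximal) auto
  define N where "N = f ` (H i - interior (H i))"
  have N: "N \<in> null_sets lebesgue"
    using finite_H_boundary[OF i] negligible_finite by (auto simp: N_def negligible_iff_null_sets)
  have VU: "V \<subseteq> U \<union> N" unfolding V_def N_def using image_sub interior_subset by blast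
  define J where "J = {j \<in> I. interior (H j) \<subseteq> f ` H i}"
  have J_V: "j \<in> J \<Longrightarrow> interior (H j) \<subseteq> V" for j
    unfolding J_def V_def by (intro interior_maximal) auto
  \<comment> \<open>Being the interior of a union of partition elements, \<open>V\<close> contains
    the interior of each of them, so each belongs to an index in \<open>J\<close>.\<close>
  have V_J: "V \<subseteq> (\<Union>j\<in>J. interior (H j)) \<union> boundary"
  proof
    fix x assume x: "x \<in> V"
    then obtain A where A: "A \<in> \<A>" "x \<in> A" using \<A> interior_subset by blast
    then obtain j where j: "j \<in> I" "A = H j"
      using \<A> enum unfolding enumerates_def bij_betw_def by blast
    have "interior (H j) \<subseteq> V" unfolding \<A>(3) using A j by (intro interior_mono) blast
    then have "j \<in> J" unfolding J_def V_def using j interior_subset by blast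
    then show "x \<in> (\<Union>j\<in>J. interior (H j)) \<union> boundary"
      using A j unfolding boundary_def by blast
  qed
  have sets_U: "U \<in> sets lebesgue" and sets_V: "V \<in> sets lebesgue"
    using \<open>open U\<close> unfolding V_def by auto
  define D where "D = interior (H i) \<inter> preim (Suc 0) E"
  have D: "D \<in> sets lebesgue" unfolding D_def using sets_preim_Suc_0[OF E(1)] by auto
  \<comment> \<open>\<open>D\<close> is the part of \<open>interior (H i)\<close> that
    \<open>f\<close> sends into \<open>E\<close>; there \<open>f\<close> is the affine map, whose
    effect on Lebesgue measure is known.\<close>
  have EU: "E \<inter> U = (\<lambda>x. s *\<^sub>R x + t) ` D"
    using st interior_subset_X[OF i] unfolding D_def U_def preim_def by force
  then have mEU: "measure lebesgue (E \<inter> U) = \<bar>s\<bar> * measure lebesgue D"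
    using measure_lebesgue_affine[of s t D] by simp
  have "emeasure lebesgue D \<le> emeasure lebesgue (H i)"
    unfolding D_def using sets_H[OF i] interior_subset by (intro emeasure_mono) auto
  then have "emeasure lebesgue (E \<inter> U) < \<infinity>"
    unfolding EU emeasure_lebesgue_affine using emeasure_H[OF i]
    by (auto simp: ennreal_mult_less_top intro: le_less_trans)
  \<comment> \<open>The exceptional points are the images of endpoints of \<open>H i\<close>,
    collected in \<open>N\<close>, and the endpoints of the partition elements.\<close>
  moreover have W: "emeasure lebesgue (\<Union>j\<in>J. E \<inter> interior (H j)) = emeasure lebesgue (E \<inter> U)"
  proof (rule emeasure_eq_null_diff[OF null_sets.Un[OF N boundary_null]])
    show "(\<Union>j\<in>J. E \<inter> interior (H j)) \<in> sets lebesgue"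
      using E(1) by (intro sets.countable_UN') auto
    show "(\<Union>j\<in>J. E \<inter> interior (H j)) \<subseteq> E \<inter> U \<union> (N \<union> boundary)" using J_V VU by blast
    show "E \<inter> U \<subseteq> (\<Union>j\<in>J. E \<inter> interior (H j)) \<union> (N \<union> boundary)" using V_J UV by blast
  qed (use E sets_U in auto)
  ultimately have hs: "((\<lambda>j. measure lebesgue (H j \<inter> E)) has_sum measure lebesgue (\<Union>j\<in>J. E \<inter> interior (H j))) J"
    by (intro has_sum_measure_H E) (auto simp: J_def)
  have "measure lebesgue (\<Union>j\<in>J. E \<inter> interior (H j)) = \<bar>s\<bar> * measure lebesgue D"
    using W mEU by (simp add: measure_def)
  moreover have "measure lebesgue D = measure lebesgue (H i \<inter> preim (Suc 0) E)"
    using D sets_H[OF i] sets_preim_Suc_0[OF E(1)] interior_subset[of "H i"] i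
    by (intro measure_eq_null_diff[OF boundary_null]) (auto simp: D_def boundary_def)
  ultimately have hs': "((\<lambda>j. measure lebesgue (H j \<inter> E)) has_sum
      \<bar>s\<bar> * measure lebesgue (H i \<inter> preim (Suc 0) E)) J" using hs by simp
  have "((\<lambda>j. inverse (measure lebesgue (H i) * \<bar>s\<bar>) * measure lebesgue (H j \<inter> E)) has_sum
      inverse (measure lebesgue (H i) * \<bar>s\<bar>) * (\<bar>s\<bar> * measure lebesgue (H i \<inter> preim (Suc 0) E))) J"
    by (rule has_sum_cmult_right[OF hs'])
  also have "inverse (measure lebesgue (H i) * \<bar>s\<bar>) * (\<bar>s\<bar> * measure lebesgue (H i \<inter> preim (Suc 0) E))
      = measure (M i) (preim (Suc 0) E)"
    using s by (simp add: measure_M[OF i sets_preim_Suc_0[OF E(1)]] field_simps)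
  also have "((\<lambda>j. inverse (measure lebesgue (H i) * \<bar>s\<bar>) * measure lebesgue (H j \<inter> E)) has_sum
      measure (M i) (preim (Suc 0) E)) J \<longleftrightarrow> ?thesis"
  proof (rule has_sum_cong_neutral)
    fix j assume "j \<in> J \<inter> I"
    then have j: "j \<in> I" "interior (H j) \<subseteq> f ` H i" by (auto simp: J_def)
    then show "inverse (measure lebesgue (H i) * \<bar>s\<bar>) * measure lebesgue (H j \<inter> E)
        = p i j * measure (M j) E"
      using measure_H_pos[OF j(1)] by (simp add: transition_matrix_def slope measure_M[OF j(1) E(1)] field_simps)
  qed (auto simp: J_def transition_matrix_def)
  finally show ?thesis .
qed

lemma measure_M_preim_Suc:
  assumes "i \<in> I" "E \<in> sets lebesgue" "E \<subseteq> X"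
  shows "measure (M i) (preim (Suc 0) E) = (\<Sum>\<^sub>\<infinity>j\<in>I. p i j * measure (M j) E)"
  using transfer[OF assms] by (simp add: infsumI)

text \<open>The row sums come from \<open>transfer\<close> with \<open>E = X\<close>:
  \<open>X\<close> is its own preimage and has full measure in every \<open>M j\<close>.\<close>

sublocale stochastic_matrix I p
proof
  show "0 \<le> p i j" for i j
    by (simp add: transition_matrix_def)
  fix i assume i: "i \<in> I"
  have "preim (Suc 0) X = X" by (auto simp: preim_def f_in_X)
  then have "((\<lambda>j. p i j * measure (M j) X) has_sum 1) I"
    using transfer[OF i sets_X] i by (simp add: measure_M_X)
  then show "(p i has_sum 1) I"
    using has_sum_cong[of I "\<lambda>j. p i j * measure (M j) X" "p i" 1] by (simp add: measure_M_X)
qed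

text \<open>By \<open>transfer\<close>, a set that is null for every \<open>M j\<close> has a
  preimage that is null for every \<open>M i\<close>; the countably many \<open>H i\<close> cover
  \<open>X\<close>.\<close>

lemma preim_null:
  assumes "N \<in> null_sets lebesgue"
  shows "preim k N \<in> null_sets lebesgue"
proof (induction k)
  case 0
  have "preim 0 N = N \<inter> X" by (auto simp: preim_def)
  with assms show ?case by (simp add: null_set_Int2)
next
  case (Suc k)
  have E: "preim k N \<in> sets lebesgue" "preim k N \<subseteq> X"
    using Suc preim_subset by auto
  have sets: "preim (Suc k) N \<in> sets lebesgue" using assms by (intro sets_preim) auto
  have "H i \<inter> preim (Suc k) N \<in> null_sets lebesgue" if i: "i \<in> I" for i
  proof -
    have "measure (M j) (preim k N) = 0" if "j \<in> I" for j
      using null_sets_M[OF that Suc] by (simp add: measure_def null_sets_def)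
    then have "measure (M i) (preim (Suc 0) (preim k N)) = 0"
      unfolding measure_M_preim_Suc[OF i E] by (intro infsum_0) auto
    then have "measure lebesgue (H i \<inter> preim (Suc k) N) = 0"
      using measure_M[OF i sets] measure_H_pos[OF i] by (simp add: preim_Suc[of k])
    moreover have "emeasure lebesgue (H i \<inter> preim (Suc k) N) \<le> emeasure lebesgue (H i)"
      using sets_H[OF i] by (intro emeasure_mono) auto
    then have "emeasure lebesgue (H i \<inter> preim (Suc k) N) = ennreal (measure lebesgue (H i \<inter> preim (Suc k) N))"
      using emeasure_H_nontrivial(2)[OF i] by (intro emeasure_eq_ennreal_measure) (auto simp: top_unique)
    ultimately show ?thesis using sets sets_H[OF i] by (auto simp: null_sets_def)
  qed
  then have "(\<Union>i\<in>I. H i \<inter> preim (Suc k) N) \<in> null_sets lebesgue"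
    by (intro null_sets_UN') auto
  moreover have "(\<Union>i\<in>I. H i \<inter> preim (Suc k) N) = preim (Suc k) N"
    using preim_subset[of "Suc k" N] X_eq by blast
  ultimately show ?case by simp
qed

text \<open>Unlike the cylinders built from the closed intervals, these are nested or disjoint.\<close>

primrec open_cylinder :: "nat list \<Rightarrow> real set" where
  "open_cylinder [] = X"
| "open_cylinder (i # w) = interior (H i) \<inter> preim (Suc 0) (open_cylinder w)"

lemma open_cylinder_subset: "open_cylinder w \<subseteq> X"
  by (cases w) (use preim_subset in auto)

lemma sets_open_cylinder: "open_cylinder w \<in> sets lebesgue"
  by (induction w) (auto simp: sets_preim_Suc_0)

text \<open>The words are compared letter by letter: different letters have disjoint interiors,
  equal letters reduce to the rest, and an exhausted word imposes no further condition. With the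
  empty set added, the open cylinders therefore form an intersection-stable generator.\<close>

lemma open_cylinder_Int:
  assumes "set v \<subseteq> I" "set w \<subseteq> I"
  shows "open_cylinder v \<inter> open_cylinder w \<in> insert {} (open_cylinder ` {u. set u \<subseteq> I})"
  using assms
proof (induction v arbitrary: w)
  case Nil
  then show ?case using open_cylinder_subset[of w] by (auto simp: Int_absorb1)
next
  case (Cons i v)
  note v = this
  show ?case
  proof (cases w)
    case Nil
    then show ?thesis using open_cylinder_subset[of "i # v"] Cons.prems
      by (intro insertI2 image_eqI[of _ _ "i # v"]) auto
  next
    case (Cons j w')
    show ?thesis
    proof (cases "i = j")
      case True
      then have eq: "open_cylinder (i # v) \<inter> open_cylinder w
          = interior (H i) \<inter> preim (Suc 0) (open_cylinder v \<inter> open_cylinder w')"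
        using Cons by (auto simp: preim_Int)
      have "open_cylinder v \<inter> open_cylinder w' \<in> insert {} (open_cylinder ` {u. set u \<subseteq> I})"
        using v Cons by auto
      then consider "open_cylinder v \<inter> open_cylinder w' = {}"
        | u where "set u \<subseteq> I" "open_cylinder v \<inter> open_cylinder w' = open_cylinder u" by blast
      then show ?thesis
      proof cases
        case 1
        then show ?thesis unfolding eq by (simp add: preim_def)
      next
        case (2 u)
        then have "open_cylinder (i # v) \<inter> open_cylinder w = open_cylinder (i # u)"
          unfolding eq by simp
        moreover have "set (i # u) \<subseteq> I" using 2 v by auto
        ultimately show ?thesis by blast
      qed
    next
      case False
      then have "interior (H i) \<inter> interior (H j) = {}"
        using v Cons by (intro interior_disjoint) auto
      then show ?thesis using Cons by auto
    qed
  qed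
qed

lemma cylinder_Nil: "cylinder X f H [] = X"
  by (simp add: cylinder_def)

lemma cylinder_Cons: "cylinder X f H (i # w) = X \<inter> H i \<inter> preim (Suc 0) (cylinder X f H w)"
  unfolding cylinder_def preim_def
  by (auto simp: All_less_Suc2 f_in_X funpow_swap1)

lemma sets_cylinder: "set w \<subseteq> I \<Longrightarrow> cylinder X f H w \<in> sets lebesgue"
  by (induction w) (auto simp: cylinder_Nil cylinder_Cons sets_preim_Suc_0)

text \<open>The points of \<open>X\<close> whose orbit ever meets an endpoint. Off this null set,
  open and closed cylinders coincide.\<close>

definition singular :: "real set" where
  "singular = (\<Union>k. preim k boundary)"

lemma singular_null: "singular \<in> null_sets lebesgue"
  unfolding singular_def by (intro null_sets_UN preim_null boundary_null)

lemma open_cylinder_subset_cylinder: "open_cylinder w \<subseteq> cylinder X f H w"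
proof (induction w)
  case (Cons i w)
  then show ?case using interior_subset[of "H i"] by (auto simp: cylinder_Cons preim_def)
qed (simp add: cylinder_Nil)

lemma cylinder_subset_open_cylinder: "set w \<subseteq> I \<Longrightarrow> cylinder X f H w \<subseteq> open_cylinder w \<union> singular"
proof (induction w)
  case (Cons i w)
  show ?case
  proof
    fix x assume "x \<in> cylinder X f H (i # w)"
    then have x: "x \<in> X" "x \<in> H i" "f x \<in> cylinder X f H w"
      by (auto simp: cylinder_Cons preim_def)
    show "x \<in> open_cylinder (i # w) \<union> singular"
    proof (rule UnCI)
      assume ns: "x \<notin> singular"
      have "x \<in> interior (H i)"
      proof (rule ccontr)
        assume "x \<notin> interior (H i)"
        then have "x \<in> preim 0 boundary" using x Cons.prems by (auto simp: preim_def boundary_def)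
        with ns show False unfolding singular_def by blast
      qed
      moreover have "f x \<notin> singular"
      proof
        assume "f x \<in> singular"
        then obtain k where "f x \<in> preim k boundary" unfolding singular_def by blast
        then have "x \<in> preim (Suc k) boundary" using x by (simp add: preim_Suc[of k]) (simp add: preim_def)
        with ns show False unfolding singular_def by blast
      qed
      ultimately show "x \<in> open_cylinder (i # w)" using x Cons by (auto simp: preim_def)
    qed
  qed
qed (simp add: cylinder_Nil)

end

section \<open>The invariant measure and mixing\<close>

locale ergodic_markov_system = markov_system +
  assumes expansive: "expansive X f I H"
    and irreducible: "chain_irreducible I (transition_matrix f H)"
    and aperiodic: "chain_aperiodic I (transition_matrix f H)"
    and positive_recurrent: "chain_positive_recurrent I (transition_matrix f H)"
begin

sublocale ergodic_chain I p
  by unfold_locales (fact irreducible aperiodic positive_recurrent)+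

text \<open>The value \<pi>(E) as a real number, written as a mixture of the \<open>M j\<close>;
  \<open>emeasure_invariant_density\<close> identifies it with the measure given by the
  density.\<close>

definition invariant_prob :: "real set \<Rightarrow> real" where
  "invariant_prob E = (\<Sum>\<^sub>\<infinity>j\<in>I. lim_prob j * measure (M j) E)"

lemma summable_invariant_prob: "(\<lambda>j. lim_prob j * measure (M j) E) summable_on I"
  using measure_M_bounds by (intro summable_lim_prob_mult) auto

lemma invariant_prob_nonneg: "0 \<le> invariant_prob E"
  unfolding invariant_prob_def using lim_prob_nonneg measure_M_bounds by (intro infsum_nonneg) auto

lemma invariant_prob_le_1: "i \<in> I \<Longrightarrow> invariant_prob E \<le> 1"
proof -
  assume "i \<in> I"
  have "invariant_prob E \<le> infsum lim_prob I"
    unfolding invariant_prob_def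
    using measure_M_bounds lim_prob_nonneg
    by (intro infsum_mono summable_invariant_prob summable_lim_prob) (auto intro!: mult_left_le)
  also have "\<dots> = 1" using infsum_lim_prob \<open>i \<in> I\<close> by blast
  finally show ?thesis .
qed

text \<open>By \<open>transfer\<close>, the numbers \<open>measure (M j) (preim k E)\<close> satisfy
  the recursion of \<open>backward_iterates_tendsto\<close>.\<close>

lemma preim_tendsto:
  assumes i: "i \<in> I" and E: "E \<in> sets lebesgue" "E \<subseteq> X"
  shows "(\<lambda>k. measure (M i) (preim k E)) \<longlonglongrightarrow> invariant_prob E"
proof -
  have "(\<lambda>k. measure (M i) (preim k E)) \<longlonglongrightarrow> (\<Sum>\<^sub>\<infinity>j\<in>I. lim_prob j * measure (M j) (preim 0 E))"
  proof (rule backward_iterates_tendsto[OF i])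
    show "measure (M j) (preim (Suc k) E) = (\<Sum>\<^sub>\<infinity>l\<in>I. p j l * measure (M l) (preim k E))"
      if "j \<in> I" for j k
      unfolding preim_Suc[of k] using that E(1) preim_subset
      by (intro measure_M_preim_Suc sets_preim) auto
  qed (rule measure_M_bounds)
  then show ?thesis unfolding invariant_prob_def preim_0[OF E(2)] .
qed

text \<open>Induction on the word. If it starts with a letter other than \<open>i\<close>, the
  cylinder is null for \<open>M i\<close>. Otherwise one application of \<open>f\<close> reduces the
  claim to an average over \<open>l\<close> of the claims for the shorter word, and dominated
  convergence passes to the limit.\<close>

lemma asymp_indep_open_cylinder:
  assumes "set w \<subseteq> I" "i \<in> I" and E: "E \<in> sets lebesgue" "E \<subseteq> X"
  shows "asymp_indep (M i) (\<lambda>k. preim k E) (invariant_prob E) (open_cylinder w)"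
  using assms(1,2)
proof (induction w arbitrary: i)
  case Nil
  have "X \<inter> preim k E = preim k E" for k using preim_subset by blast
  then show ?case
    using preim_tendsto[OF Nil(2) E] measure_M_X[OF Nil(2)] by (simp add: asymp_indep_def)
next
  case (Cons j w)
  let ?C = "open_cylinder w"
  show ?case
  proof (cases "i = j")
    case False
    have "H i \<inter> interior (H j) \<subseteq> boundary"
      using interior_disjoint[OF Cons.prems(2) _ False] Cons.prems unfolding boundary_def by auto
    then have sub: "H i \<inter> (open_cylinder (j # w) \<inter> F) \<subseteq> boundary" for F by auto
    have "measure (M i) (open_cylinder (j # w) \<inter> F) = 0" if "F \<in> sets lebesgue" for F
    proof -
      have "measure lebesgue (H i \<inter> (open_cylinder (j # w) \<inter> F)) = measure lebesgue ({} :: real set)"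
      proof (rule measure_eq_null_diff[OF boundary_null])
        show "H i \<inter> (open_cylinder (j # w) \<inter> F) \<in> sets lebesgue"
          by (intro sets.Int sets_H Cons.prems(2) sets_open_cylinder that)
      qed (use sub in auto)
      moreover have "open_cylinder (j # w) \<inter> F \<in> sets lebesgue"
        using sets_open_cylinder that by blast
      ultimately show ?thesis using measure_M[OF Cons.prems(2)] by simp
    qed
    from this[of UNIV] this[OF sets_preim[OF E(1)]] show ?thesis
      by (simp add: asymp_indep_def del: open_cylinder.simps)
  next
    case True
    have restrict: "measure (M i) (interior (H i) \<inter> F) = measure (M i) F" if F: "F \<in> sets lebesgue" for F
    proof -
      have "measure lebesgue (H i \<inter> (interior (H i) \<inter> F)) = measure lebesgue (H i \<inter> F)"
      proof (rule measure_eq_null_diff[OF boundary_null])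
        show "H i \<inter> (interior (H i) \<inter> F) \<in> sets lebesgue" "H i \<inter> F \<in> sets lebesgue"
          by (intro sets.Int sets_H Cons.prems(2) F; simp)+
      qed (use Cons.prems(2) in \<open>auto simp: boundary_def\<close>)
      moreover have "interior (H i) \<inter> F \<in> sets lebesgue" using F by auto
      ultimately show ?thesis using measure_M[OF Cons.prems(2)] F by simp
    qed
    \<comment> \<open>One step consumes the first letter and one unit of time, hence
      \<open>Suc k\<close> on the left and \<open>k\<close> on the right; the shift does not affect
      the limit.\<close>
    have eq: "measure (M i) (open_cylinder (j # w) \<inter> preim (Suc k) E)
        = (\<Sum>\<^sub>\<infinity>l\<in>I. p i l * measure (M l) (?C \<inter> preim k E))" for k
    proof -
      have "open_cylinder (j # w) \<inter> preim (Suc k) E = interior (H i) \<inter> preim (Suc 0) (?C \<inter> preim k E)"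
        using True by (simp add: preim_Int preim_Suc[of k] Int_assoc)
      moreover have "?C \<inter> preim k E \<in> sets lebesgue" "?C \<inter> preim k E \<subseteq> X"
        using sets_open_cylinder sets_preim[OF E(1)] open_cylinder_subset by auto
      ultimately show ?thesis
        using restrict sets_preim_Suc_0 measure_M_preim_Suc[OF Cons.prems(2)] by simp
    qed
    have lim: "(\<lambda>k. \<Sum>\<^sub>\<infinity>l\<in>I. p i l * measure (M l) (?C \<inter> preim k E))
        \<longlonglongrightarrow> (\<Sum>\<^sub>\<infinity>l\<in>I. p i l * (invariant_prob E * measure (M l) ?C))"
    proof (rule infsum_dominated_convergence[OF _ _ summable_p[OF Cons.prems(2)]])
      show "(\<lambda>k. p i l * measure (M l) (?C \<inter> preim k E)) \<longlonglongrightarrow> p i l * (invariant_prob E * measure (M l) ?C)"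
        if "l \<in> I" for l
        using Cons that unfolding asymp_indep_def by (intro tendsto_mult_left) auto
      show "\<bar>p i l * measure (M l) (?C \<inter> preim k E)\<bar> \<le> p i l" if "l \<in> I" for l k
        using measure_M_bounds[OF that] p_nonneg[OF Cons.prems(2) that]
        by (auto simp: abs_mult intro!: mult_left_le)
    qed
    have "(\<Sum>\<^sub>\<infinity>l\<in>I. p i l * (invariant_prob E * measure (M l) ?C))
        = invariant_prob E * (\<Sum>\<^sub>\<infinity>l\<in>I. p i l * measure (M l) ?C)"
      unfolding infsum_cmult_right'[symmetric] by (rule infsum_cong) simp
    also have "(\<Sum>\<^sub>\<infinity>l\<in>I. p i l * measure (M l) ?C) = measure (M i) (preim (Suc 0) ?C)"
      by (rule measure_M_preim_Suc[OF Cons.prems(2) sets_open_cylinder open_cylinder_subset, symmetric])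
    also have "\<dots> = measure (M i) (open_cylinder (j # w))"
      using restrict[OF sets_preim_Suc_0[OF sets_open_cylinder]] True by simp
    finally have "(\<lambda>k. measure (M i) (open_cylinder (j # w) \<inter> preim (Suc k) E))
        \<longlonglongrightarrow> invariant_prob E * measure (M i) (open_cylinder (j # w))"
      using lim unfolding eq by simp
    then show ?thesis unfolding asymp_indep_def by (rule LIMSEQ_imp_Suc)
  qed
qed

lemma asymp_indep_lebesgue:
  assumes i: "i \<in> I" and E: "E \<in> sets lebesgue" "E \<subseteq> X" and B: "B \<in> sets lebesgue"
  shows "asymp_indep (M i) (\<lambda>k. preim k E) (invariant_prob E) B"
proof -
  interpret prob_space "M i" by (rule prob_space_M[OF i])
  let ?indep = "asymp_indep (M i) (\<lambda>k. preim k E) (invariant_prob E)"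
  let ?G = "insert {} (open_cylinder ` {w. set w \<subseteq> I})"
  have T: "preim k E \<in> sets (M i)" for k using sets_preim[OF E(1)] by simp
  have c: "0 \<le> invariant_prob E" "invariant_prob E \<le> 1"
    using invariant_prob_nonneg invariant_prob_le_1[OF i] by auto
  have G: "?G \<subseteq> Pow X" using open_cylinder_subset by auto
  interpret generated: sigma_algebra X "sigma_sets X ?G"
    by (rule sigma_algebra_sigma_sets[OF G])
  have sets_G: "sigma_sets X ?G \<subseteq> sets lebesgue"
    using sets_open_cylinder sets_X
    by (intro sets.sigma_sets_subset') auto
  have stable: "Int_stable ?G"
    unfolding Int_stable_def using open_cylinder_Int by auto
  \<comment> \<open>Dynkin's theorem for the sigma-algebra on \<open>X\<close> generated by the open
    cylinders; the empty word provides \<open>X\<close> itself.\<close>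
  have indep_G: "?indep F" if "F \<in> sigma_sets X ?G" for F
    using stable G that
  proof (induction F rule: sigma_sets_induct_disjoint)
    case (basic A)
    then show ?case using asymp_indep_open_cylinder[OF _ i E] asymp_indep_empty by auto
  next
    case empty
    show ?case by (rule asymp_indep_empty)
  next
    case (compl A)
    have "?indep X" using asymp_indep_open_cylinder[OF _ i E, of "[]"] by simp
    moreover have "A \<subseteq> X" using sigma_sets_into_sp[OF G] compl by blast
    ultimately show ?case
      using compl sets_G T by (intro asymp_indep_Diff) auto
  next
    case (union A)
    then show ?case using sets_G T by (intro asymp_indep_UN) auto
  qed
  have interval: "?indep J" if J: "is_interval J" "J \<subseteq> H i" "J \<in> sets lebesgue" for J
  proof (rule asymp_indep_approx)
    fix e :: real assume "e > 0"
    \<comment> \<open>Expansivity is applied with this tolerance because \<open>M i\<close> divides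
      Lebesgue measure by that of \<open>H i\<close>.\<close>
    then have "e * measure lebesgue (H i) > 0" using measure_H_pos[OF i] by simp
    moreover have "bounded J"
      using H_obtain[OF i] J(2) bounded_closed_interval bounded_subset by metis
    moreover have "J \<subseteq> X" using J(2) X_eq i by blast
    ultimately obtain W where W: "finite W" "\<And>w. w \<in> W \<Longrightarrow> set w \<subseteq> I"
      "emeasure lebesgue (sym_diff J (\<Union>w\<in>W. cylinder X f H w)) < ennreal (e * measure lebesgue (H i))"
      using expansive J(1) unfolding expansive_def by meson
    define U where "U = (\<Union>w\<in>W. cylinder X f H w)"
    define B' where "B' = (\<Union>w\<in>W. open_cylinder w)"
    have U: "U \<in> sets lebesgue" unfolding U_def using W sets_cylinder by (intro sets.finite_UN) auto
    have B'_sigma: "B' \<in> sigma_sets X ?G"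
      unfolding B'_def using W(2)
      by (intro generated.finite_UN W(1)) auto
    have B': "B' \<in> sets lebesgue" using B'_sigma sets_G by blast
    \<comment> \<open>Expansivity supplies closed cylinders; replacing them by open ones changes the
      union only by a null set and places it in the generated sigma-algebra.\<close>
    have "B' \<subseteq> U" "U \<subseteq> B' \<union> singular"
      unfolding B'_def U_def using open_cylinder_subset_cylinder cylinder_subset_open_cylinder W(2) by fast+
    then have "measure (M i) (sym_diff J B') = measure (M i) (sym_diff J U)"
      using J(3) U B' by (intro measure_eq_null_diff[OF null_sets_M[OF i singular_null]]) auto
    also have "\<dots> = measure lebesgue (H i \<inter> sym_diff J U) / measure lebesgue (H i)"
      using J(3) U by (intro measure_M[OF i]) auto
    also have "\<dots> < e"
    proof -
      have "emeasure lebesgue (H i \<inter> sym_diff J U) \<le> emeasure lebesgue (sym_diff J U)"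
        using J(3) U by (intro emeasure_mono) auto
      also have "\<dots> < ennreal (e * measure lebesgue (H i))" using W(3) unfolding U_def .
      finally have "measure lebesgue (H i \<inter> sym_diff J U) < e * measure lebesgue (H i)"
        using \<open>e * measure lebesgue (H i) > 0\<close>
        by (metis emeasure_eq_ennreal_measure ennreal_less_iff ennreal_less_top less_imp_neq less_trans measure_nonneg)
      then show ?thesis using measure_H_pos[OF i] by (simp add: divide_less_eq)
    qed
    finally show "\<exists>B'\<in>sets (M i). ?indep B' \<and> measure (M i) (sym_diff J B') < e"
      using B' indep_G[OF B'_sigma] by auto
  qed (use T c J(3) in auto)
  \<comment> \<open>\<open>M i\<close> is concentrated on \<open>H i\<close>, so only the trace of a
    set on \<open>H i\<close> matters.\<close>
  have restrict: "?indep F" if F: "?indep (F \<inter> H i)" "F \<in> sets lebesgue" for F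
  proof -
    have "measure (M i) (F \<inter> H i \<inter> F') = measure (M i) (F \<inter> F')" if "F' \<in> sets lebesgue" for F'
    proof -
      have "H i \<inter> (F \<inter> H i \<inter> F') = H i \<inter> (F \<inter> F')" by blast
      then show ?thesis using F(2) that sets_H[OF i] by (simp add: measure_M[OF i])
    qed
    from this[of UNIV] this[OF sets_preim[OF E(1)]] F(1) show ?thesis
      by (simp add: asymp_indep_def)
  qed
  have "is_interval (H i)"
    using H_obtain[OF i] is_interval_cc by metis
  then have indep_UNIV: "?indep UNIV"
    using restrict[of UNIV] interval[of "H i"] sets_H[OF i] by simp
  \<comment> \<open>A second use of Dynkin's theorem, now for the closed half-lines, whose traces on
    \<open>H i\<close> are intervals.\<close>
  have indep_borel: "?indep F" if "F \<in> sets borel" for F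
  proof -
    have stable: "Int_stable (range (\<lambda>a::real. {..a}))"
      by (auto simp: Int_stable_def)
    have borel: "sigma_sets UNIV (range (\<lambda>a::real. {..a})) = sets borel"
      by (subst borel_eq_atMost) (simp add: sets_measure_of)
    have F: "F \<in> sigma_sets UNIV (range (\<lambda>a::real. {..a}))" using that borel by simp
    have "range (\<lambda>a::real. {..a}) \<subseteq> Pow UNIV" by simp
    from stable this F show ?thesis
    proof (induction F rule: sigma_sets_induct_disjoint)
      case (basic A)
      then obtain a where a: "A = {..a}" by blast
      have "is_interval ({..a} \<inter> H i)"
        using \<open>is_interval (H i)\<close> by (intro is_interval_Int is_interval_ic)
      then have "?indep ({..a} \<inter> H i)"
        by (rule interval) (use sets_H[OF i] in auto)
      then show ?case
        unfolding a by (rule restrict) simp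
    next
      case empty
      show ?case by (rule asymp_indep_empty)
    next
      case (compl A)
      then show ?case using indep_UNIV T borel by (intro asymp_indep_Diff) auto
    next
      case (union A)
      then show ?case using T borel by (intro asymp_indep_UN) auto
    qed
  qed
  \<comment> \<open>A Lebesgue set is a Borel set up to a null set, which \<open>M i\<close> does
    not see.\<close>
  obtain S N N' where S: "B = S \<union> N" "N \<subseteq> N'" "N' \<in> null_sets lborel" "S \<in> sets lborel"
    using B by (rule sets_completionE)
  have N': "N' \<in> null_sets (M i)"
    using S(3) by (intro null_sets_M[OF i] null_sets_completionI)
  have "measure (M i) (B \<inter> F) = measure (M i) (S \<inter> F)" if "F \<in> sets lebesgue" for F
    using S B that by (intro measure_eq_null_diff[OF N']) auto
  from this[of UNIV] this[OF sets_preim[OF E(1)]] show ?thesis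
    using indep_borel[of S] S(4) by (simp add: asymp_indep_def)
qed

lemma invariant_prob_mixing:
  assumes E: "E \<in> sets lebesgue" "E \<subseteq> X" and B: "B \<in> sets lebesgue"
  shows "(\<lambda>k. invariant_prob (B \<inter> preim k E)) \<longlonglongrightarrow> invariant_prob E * invariant_prob B"
proof -
  have "(\<lambda>k. \<Sum>\<^sub>\<infinity>j\<in>I. lim_prob j * measure (M j) (B \<inter> preim k E))
      \<longlonglongrightarrow> (\<Sum>\<^sub>\<infinity>j\<in>I. lim_prob j * (invariant_prob E * measure (M j) B))"
  proof (rule infsum_dominated_convergence[OF _ _ summable_lim_prob])
    show "(\<lambda>k. lim_prob j * measure (M j) (B \<inter> preim k E))
        \<longlonglongrightarrow> lim_prob j * (invariant_prob E * measure (M j) B)" if "j \<in> I" for j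
      using asymp_indep_lebesgue[OF that E B] unfolding asymp_indep_def by (rule tendsto_mult_left)
    show "\<bar>lim_prob j * measure (M j) (B \<inter> preim k E)\<bar> \<le> lim_prob j" if "j \<in> I" for j k
      using measure_M_bounds[OF that] lim_prob_nonneg[OF that]
      by (auto simp: abs_mult intro!: mult_left_le)
  qed
  also have "(\<Sum>\<^sub>\<infinity>j\<in>I. lim_prob j * (invariant_prob E * measure (M j) B))
      = invariant_prob E * invariant_prob B"
    unfolding invariant_prob_def[of B] infsum_cmult_right'[symmetric]
    by (rule infsum_cong) simp
  finally show ?thesis unfolding invariant_prob_def[of "B \<inter> preim _ E"] .
qed

text \<open>On the interior of \<open>H j\<close> the density is constant, so that piece of
  \<open>E\<close> receives the mass \<open>lim_prob j * measure (M j) E\<close>. The rest of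
  \<open>X\<close> lies in the null set \<open>boundary\<close>, and countable additivity sums up
  the pieces.\<close>

lemma emeasure_invariant_density:
  assumes \<tau>: "\<tau> \<in> borel_measurable (lebesgue_on X)"
    and \<tau>_eq: "\<And>i x. i \<in> I \<Longrightarrow> x \<in> interior (H i) \<Longrightarrow>
      \<tau> x = ennreal (lim_prob i / measure lebesgue (H i))"
    and E: "E \<in> sets lebesgue" "E \<subseteq> X"
  shows "emeasure (density (lebesgue_on X) \<tau>) E = ennreal (invariant_prob E)"
proof -
  let ?D = "density (lebesgue_on X) \<tau>"
  have sets_D: "F \<in> sets ?D" if "F \<in> sets lebesgue" "F \<subseteq> X" for F
    using that by (simp add: sets_restrict_space_iff)
  define F where "F = (\<lambda>j. if j \<in> I then E \<inter> interior (H j) else {})"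
  have F: "F j \<in> sets lebesgue" "F j \<subseteq> X" for j
    using E by (auto simp: F_def)
  have disj: "disjoint_family F"
    using interior_disjoint by (auto simp: F_def disjoint_family_on_def split: if_splits)
  have piece: "emeasure ?D (F j) = ennreal (if j \<in> I then lim_prob j * measure (M j) E else 0)" for j
  proof (cases "j \<in> I")
    case True
    have "emeasure ?D (F j) = (\<integral>\<^sup>+x. \<tau> x * indicator (F j) x \<partial>lebesgue_on X)"
      using F sets_D[OF F] by (intro emeasure_density[OF \<tau>]) simp
    also have "\<dots> = (\<integral>\<^sup>+x. ennreal (lim_prob j / measure lebesgue (H j)) * indicator (F j) x \<partial>lebesgue_on X)"
      using True by (intro nn_integral_cong) (auto simp: F_def \<tau>_eq split: split_indicator)
    also have "\<dots> = ennreal (lim_prob j / measure lebesgue (H j)) * emeasure (lebesgue_on X) (F j)"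
      using sets_D[OF F] by (intro nn_integral_cmult_indicator) simp
    also have "emeasure (lebesgue_on X) (F j) = emeasure lebesgue (F j)"
      using F sets_X by (intro emeasure_restrict_space) auto
    also have "\<dots> = emeasure lebesgue (H j \<inter> E)"
      using F E True interior_subset[of "H j"] sets_H[OF True]
      by (intro emeasure_eq_null_diff[OF boundary_null]) (auto simp: F_def boundary_def)
    also have "\<dots> = ennreal (measure lebesgue (H j \<inter> E))"
    proof (rule emeasure_eq_ennreal_measure)
      have "emeasure lebesgue (H j \<inter> E) \<le> emeasure lebesgue (H j)"
        using sets_H[OF True] by (intro emeasure_mono) auto
      then show "emeasure lebesgue (H j \<inter> E) \<noteq> top"
        using emeasure_H_nontrivial(2)[OF True] by (auto simp: top_unique)
    qed
    also have "ennreal (lim_prob j / measure lebesgue (H j)) * ennreal (measure lebesgue (H j \<inter> E))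
        = ennreal (lim_prob j * measure (M j) E)"
      using lim_prob_nonneg[OF True] by (simp add: measure_M[OF True E(1)] flip: ennreal_mult)
    finally show ?thesis using True by simp
  qed (simp add: F_def)
  have "boundary \<inter> X \<in> null_sets (lebesgue_on X)"
    using null_set_Int2[OF boundary_null sets_X] sets_X by (subst null_sets_restrict_space) auto
  then have "boundary \<inter> X \<in> null_sets ?D"
    using AE_not_in[of "boundary \<inter> X" "lebesgue_on X"]
    by (subst null_sets_density_iff[OF \<tau>]) (auto elim: eventually_mono)
  then have "emeasure ?D E = emeasure ?D (\<Union>j. F j)"
  proof (rule emeasure_eq_null_diff)
    show "E \<subseteq> (\<Union>j. F j) \<union> boundary \<inter> X"
      using E X_cover by (fastforce simp: F_def)
    have "(\<Union>j. F j) \<in> sets lebesgue" "(\<Union>j. F j) \<subseteq> X" using F by blast+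
    then show "(\<Union>j. F j) \<in> sets ?D" by (rule sets_D)
  qed (use E sets_D in \<open>auto simp: F_def split: if_splits\<close>)
  also have "\<dots> = (\<Sum>j. emeasure ?D (F j))"
    using sets_D[OF F] disj by (intro suminf_emeasure[symmetric]) auto
  also have "\<dots> = (\<Sum>j. ennreal (if j \<in> I then lim_prob j * measure (M j) E else 0))"
    unfolding piece ..
  also have "\<dots> = ennreal (invariant_prob E)"
  proof (rule suminf_ennreal_eq)
    have "((\<lambda>j. lim_prob j * measure (M j) E) has_sum invariant_prob E) I"
      unfolding invariant_prob_def by (rule has_sum_infsum[OF summable_invariant_prob])
    also have "?this \<longleftrightarrow> ((\<lambda>j. if j \<in> I then lim_prob j * measure (M j) E else 0) has_sum invariant_prob E) UNIV"
      by (rule has_sum_cong_neutral) auto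
    finally show "(\<lambda>j. if j \<in> I then lim_prob j * measure (M j) E else 0) sums invariant_prob E"
      by (rule has_sum_imp_sums)
  qed (use lim_prob_nonneg measure_M_bounds in auto)
  finally show ?thesis .
qed

theorem mixing_density:
  assumes "\<tau> \<in> borel_measurable (lebesgue_on X)"
    and "\<And>i x. i \<in> I \<Longrightarrow> x \<in> interior (H i) \<Longrightarrow>
      \<tau> x = ennreal (lim_prob i / measure lebesgue (H i))"
  shows "mixing (density (lebesgue_on X) \<tau>) f"
  unfolding mixing_def
proof (intro ballI)
  let ?D = "density (lebesgue_on X) \<tau>"
  fix A B assume "A \<in> sets ?D" "B \<in> sets ?D"
  then have A: "A \<in> sets lebesgue" "A \<subseteq> X" and B: "B \<in> sets lebesgue" "B \<subseteq> X"
    by (auto simp: sets_restrict_space_iff)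
  have "emeasure ?D ({x \<in> space ?D. (f ^^ k) x \<in> A} \<inter> B) = ennreal (invariant_prob (B \<inter> preim k A))" for k
  proof -
    have "{x \<in> space ?D. (f ^^ k) x \<in> A} \<inter> B = B \<inter> preim k A"
      by (auto simp: preim_def space_restrict_space)
    moreover have "B \<inter> preim k A \<in> sets lebesgue" "B \<inter> preim k A \<subseteq> X"
      using A B sets_preim by auto
    ultimately show ?thesis using emeasure_invariant_density[OF assms] by simp
  qed
  moreover have "emeasure ?D A * emeasure ?D B = ennreal (invariant_prob A * invariant_prob B)"
    using emeasure_invariant_density[OF assms A] emeasure_invariant_density[OF assms B] invariant_prob_nonneg
    by (simp add: ennreal_mult)
  ultimately show "(\<lambda>k. emeasure ?D ({x \<in> space ?D. (f ^^ k) x \<in> A} \<inter> B))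
      \<longlonglongrightarrow> emeasure ?D A * emeasure ?D B"
    using tendsto_ennrealI[OF invariant_prob_mixing[OF A B(1)]] by simp
qed

end

theorem corollary5p4:
  fixes X :: "real set" and f :: "real \<Rightarrow> real" and \<H> :: "real set set"
    and I :: "nat set" and H :: "nat \<Rightarrow> real set" and \<tau> :: "real \<Rightarrow> ennreal"
  assumes "interval_system X f"
    and "linear_markov_partition X f \<H>"
    and "enumerates I H \<H>"
    and "expansive X f I H"
    and "\<forall>i\<in>I. emeasure lebesgue (H i) < \<infinity>"
    and "chain_irreducible I (transition_matrix f H)"
    and "chain_aperiodic I (transition_matrix f H)"
    and "chain_positive_recurrent I (transition_matrix f H)"
    and "\<tau> \<in> borel_measurable (lebesgue_on X)"
    and "\<forall>i\<in>I. \<forall>x\<in>interior (H i).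
           \<tau> x = ennreal (lim (\<lambda>k. matpow I (transition_matrix f H) k i i)
                          / measure lebesgue (H i))"
  shows "mixing (density (lebesgue_on X) \<tau>) f"
proof -
  interpret ergodic_markov_system X f \<H> I H
    by unfold_locales (use assms in auto)
  show ?thesis
    by (rule mixing_density) (use assms(9,10) in \<open>auto simp: lim_prob_def\<close>)
qed

end
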